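(* (Hopf Lemma) Let $\Omega\subset\mathbb{R}^n$ be open and connected. Let $F(x,s,p,M)$ be continuous on $\overline\Omega\times\mathbb{R}\times\mathbb{R}^n\times\mathcal{S}^{n\times n}$ and of class $C^1$ in $(s,p,M)$, and elliptic: the matrix $\big(\frac{\partial F}{\partial M_{ij}}\big)$ is positive definite for all values of the arguments. Let $u\in LSC(\overline\Omega)$ and $v\in C^2(\overline\Omega)$ satisfy $$F(x,u,\nabla u,\nabla^2u)\le F(x,v,\nabla v,\nabla^2v)\quad\text{in }\Omega\text{ in the viscosity sense},$$ with $u>v$ in $\Omega$, and suppose $u(\hat x)=v(\hat x)$ at a boundary point $\hat x\in\partial\Omega$ near which $\partial\Omega$ is $C^2$. Then, if $\nu$ is the unit interior normal to $\partial\Omega$ at $\hat x$, $$\liminf_{s\to0^+}\frac{(u-v)(\hat x+s\nu)}{s}>0.$$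
   Context: $\mathcal{S}^{n\times n}$ is the set of real symmetric $n\times n$ matrices; $LSC(\overline\Omega)$ is the set of lower-semicontinuous functions on $\overline\Omega$. "Of class $C^1$ in $(s,p,M)$" means that the partial derivatives of $F$ in $(s,p,M)$ exist and are continuous functions of $(x,s,p,M)$. No uniform ellipticity and no uniform bound on $|F_s|,|F_{p_i}|$ is assumed. Viscosity sense: whenever $x_0\in\Omega$ and $\varphi$ is $C^2$ near $x_0$ with $\varphi\le u$ near $x_0$ and $\varphi(x_0)=u(x_0)$, one has $F(x_0,\varphi(x_0),\nabla\varphi(x_0),\nabla^2\varphi(x_0))\le F(x_0,v(x_0),\nabla v(x_0),\nabla^2v(x_0))$. *)

theory Defs
  imports "HOL-Analysis.Analysis"
begin

definition gradient :: "(real^'n \<Rightarrow> real) \<Rightarrow> real^'n \<Rightarrow> real^'n" where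
  "gradient f x = (\<chi> i. frechet_derivative f (at x) (axis i 1))"

definition hessian :: "(real^'n \<Rightarrow> real) \<Rightarrow> real^'n \<Rightarrow> real^'n^'n" where
  "hessian f x = jacobian (gradient f) (at x)"

(* Meaningful for open U only; it is always used with an open set. *)
definition C2_on :: "(real^'n) set \<Rightarrow> (real^'n \<Rightarrow> real) \<Rightarrow> bool" where
  "C2_on U f \<longleftrightarrow>
     (\<forall>x\<in>U. f differentiable at x \<and> gradient f differentiable at x) \<and>
     continuous_on U (hessian f)"

(* The class C^2(closure Omega) for open Omega: f is C^2 in Omega, and f and its derivatives of
   first and second order extend continuously to the closure (f being its own extension).
   No regularity of the boundary and no extension of f beyond the closure is required. *)
definition C2_on_closure :: "(real^'n) set \<Rightarrow> (real^'n \<Rightarrow> real) \<Rightarrow> bool" where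
  "C2_on_closure \<Omega> f \<longleftrightarrow>
     C2_on \<Omega> f \<and> continuous_on (closure \<Omega>) f \<and>
     (\<exists>G. continuous_on (closure \<Omega>) G \<and> (\<forall>x\<in>\<Omega>. G x = gradient f x)) \<and>
     (\<exists>H. continuous_on (closure \<Omega>) H \<and> (\<forall>x\<in>\<Omega>. H x = hessian f x))"

definition lsc_on :: "'a::topological_space set \<Rightarrow> ('a \<Rightarrow> real) \<Rightarrow> bool" where
  "lsc_on S u \<longleftrightarrow> (\<forall>x\<in>S. \<forall>c<u x. \<forall>\<^sub>F y in at x within S. c < u y)"

definition sym_matrices :: "(real^'n^'n) set" where
  "sym_matrices = {M. transpose M = M}"

definition pos_def :: "real^'n^'n \<Rightarrow> bool" where
  "pos_def A \<longleftrightarrow> (\<forall>\<xi>. \<xi> \<noteq> 0 \<longrightarrow> 0 < \<xi> \<bullet> (A *v \<xi>))"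

(* The symmetric part of the matrix unit E_ij. *)
definition sym_unit :: "'n \<Rightarrow> 'n \<Rightarrow> real^'n^'n" where
  "sym_unit i j = (\<chi> k l. ((if k = i \<and> l = j then 1 else 0) + (if k = j \<and> l = i then 1 else 0)) / 2)"

(* A nonlinearity F(x,s,p,M) is a curried function; only its values at symmetric M matter. *)
type_synonym 'n nonlinearity = "real^'n \<Rightarrow> real \<Rightarrow> real^'n \<Rightarrow> real^'n^'n \<Rightarrow> real"

definition partial_s :: "'n::finite nonlinearity \<Rightarrow> 'n nonlinearity" where
  "partial_s F x s p M = deriv (\<lambda>t. F x t p M) s"

definition partial_p ::
  "'n::finite nonlinearity \<Rightarrow> real^'n \<Rightarrow> real \<Rightarrow> real^'n \<Rightarrow> real^'n^'n \<Rightarrow> real^'n" where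
  "partial_p F x s p M = (\<chi> i. deriv (\<lambda>t. F x s (p + t *\<^sub>R axis i 1) M) 0)"

(* The matrix (dF/dM_ij) for F defined on symmetric M, normalised as usual so that
   dF = (sum over all i, j of (dF/dM_ij) dM_ij); thus F = trace (A M) with A symmetric gives A.
   Differentiating along sym_unit i j keeps the argument in sym_matrices, and it gives the
   ordinary partial derivatives of M |-> F(x,s,p,(M + transpose M)/2). *)
definition partial_M ::
  "'n::finite nonlinearity \<Rightarrow> real^'n \<Rightarrow> real \<Rightarrow> real^'n \<Rightarrow> real^'n^'n \<Rightarrow> real^'n^'n" where
  "partial_M F x s p M = (\<chi> i j. deriv (\<lambda>t. F x s p (M + t *\<^sub>R sym_unit i j)) 0)"

definition C1_in_spM :: "(real^'n::finite) set \<Rightarrow> 'n nonlinearity \<Rightarrow> bool" where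
  "C1_in_spM X F \<longleftrightarrow>
     (\<forall>x\<in>X. \<forall>s p. \<forall>M\<in>sym_matrices.
        (\<lambda>t. F x t p M) field_differentiable at s \<and>
        (\<forall>i. (\<lambda>t. F x s (p + t *\<^sub>R axis i 1) M) field_differentiable at 0) \<and>
        (\<forall>i j. (\<lambda>t. F x s p (M + t *\<^sub>R sym_unit i j)) field_differentiable at 0)) \<and>
     continuous_on (X \<times> UNIV \<times> UNIV \<times> sym_matrices) (\<lambda>(x, s, p, M). partial_s F x s p M) \<and>
     continuous_on (X \<times> UNIV \<times> UNIV \<times> sym_matrices) (\<lambda>(x, s, p, M). partial_p F x s p M) \<and>
     continuous_on (X \<times> UNIV \<times> UNIV \<times> sym_matrices) (\<lambda>(x, s, p, M). partial_M F x s p M)"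

definition elliptic_on :: "(real^'n::finite) set \<Rightarrow> 'n nonlinearity \<Rightarrow> bool" where
  "elliptic_on X F \<longleftrightarrow> (\<forall>x\<in>X. \<forall>s p. \<forall>M\<in>sym_matrices. pos_def (partial_M F x s p M))"

(* F(x, u, Du, D^2 u) \<le> F(x, v, Dv, D^2 v) in Omega in the viscosity sense; v is classical. *)
definition viscosity_le ::
  "(real^'n::finite) set \<Rightarrow> 'n nonlinearity \<Rightarrow> (real^'n \<Rightarrow> real) \<Rightarrow> (real^'n \<Rightarrow> real) \<Rightarrow> bool" where
  "viscosity_le \<Omega> F u v \<longleftrightarrow>
     (\<forall>x0\<in>\<Omega>. \<forall>\<phi> U. open U \<and> x0 \<in> U \<and> C2_on U \<phi> \<and>
        (\<forall>\<^sub>F x in nhds x0. \<phi> x \<le> u x) \<and> \<phi> x0 = u x0 \<longrightarrow>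
        F x0 (\<phi> x0) (gradient \<phi> x0) (hessian \<phi> x0) \<le> F x0 (v x0) (gradient v x0) (hessian v x0))"

(* Near x0, Omega is the region above a regular level set of the C^2 function rho, so Omega lies
   locally on one side of its boundary and the interior normal is determined. *)
definition C2_defining_function ::
  "(real^'n) set \<Rightarrow> real^'n \<Rightarrow> (real^'n) set \<Rightarrow> (real^'n \<Rightarrow> real) \<Rightarrow> bool" where
  "C2_defining_function \<Omega> x0 U \<rho> \<longleftrightarrow>
     open U \<and> x0 \<in> U \<and> C2_on U \<rho> \<and> (\<forall>x\<in>U. gradient \<rho> x \<noteq> 0) \<and>
     \<Omega> \<inter> U = {x\<in>U. 0 < \<rho> x} \<and> frontier \<Omega> \<inter> U = {x\<in>U. \<rho> x = 0}"

definition C2_boundary_near :: "(real^'n) set \<Rightarrow> real^'n \<Rightarrow> bool" where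
  "C2_boundary_near \<Omega> x0 \<longleftrightarrow> (\<exists>U \<rho>. C2_defining_function \<Omega> x0 U \<rho>)"

definition unit_interior_normal :: "(real^'n) set \<Rightarrow> real^'n \<Rightarrow> real^'n \<Rightarrow> bool" where
  "unit_interior_normal \<Omega> x0 \<nu> \<longleftrightarrow>
     (\<exists>U \<rho>. C2_defining_function \<Omega> x0 U \<rho> \<and> \<nu> = gradient \<rho> x0 /\<^sub>R norm (gradient \<rho> x0))"

end

theory Submission
  imports Defs
begin

text \<open>The proof is Hopf's barrier argument, carried out in the viscosity sense.

Since the boundary is \<open>C\<^sup>2\<close> near \<open>xhat\<close>, a closed ball of some radius \<open>R\<close> and centre
\<open>y = xhat + R \<nu>\<close> lies in \<open>\<Omega> \<union> {xhat}\<close> (\<open>interior_ball\<close>). On the lens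
\<open>K = cball y R \<inter> cball xhat (R/2)\<close> compare \<open>u - v\<close> with the barrier
\<open>b x = \<epsilon> (exp (- \<alpha> |x - y|\<^sup>2) - exp (- \<alpha> R\<^sup>2))\<close>, which vanishes on the sphere \<open>|x - y| = R\<close> and grows
linearly along \<open>\<nu>\<close>. So \<open>u - v \<ge> b\<close> on \<open>K\<close> is all that is needed.

On the part of the boundary of \<open>K\<close> where \<open>|x - y| = R\<close>, the barrier is zero and \<open>u - v \<ge> 0\<close>. On the part
where \<open>|x - xhat| = R/2\<close>, a compact subset of \<open>\<Omega>\<close>, the lower semicontinuous function \<open>u - v\<close> has a
positive minimum, which exceeds \<open>b\<close> once \<open>\<epsilon>\<close> is small. Hence if \<open>u - v - b\<close> had a negative minimum over
\<open>K\<close>, it would be attained at an interior point \<open>z\<close>, and \<open>v + b\<close> plus that minimum would touch \<open>u\<close> from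
below at \<open>z\<close>. The viscosity inequality at \<open>z\<close> says that adding to \<open>(v, Dv, D\<^sup>2v)\<close> the increments
\<open>(u z - v z, Db z, D\<^sup>2b z)\<close> does not increase \<open>F\<close>.

This is impossible (\<open>gaussian_perturbation_increases\<close>). By the mean value theorem
(\<open>nonlinearity_mean_value\<close>) the change of \<open>F\<close> is a linear combination of the increments, the
coefficients being derivatives of \<open>F\<close> at arguments in a fixed compact set; there they are bounded and the
ellipticity is uniform (\<open>uniform_bounds_of_coefficients\<close>). The second derivative of the
exponential contributes a term of order \<open>\<alpha>\<^sup>2\<close> with a good sign, as \<open>|x - y| \<ge> R/2\<close> on \<open>K\<close>, and all other
terms are \<open>O(\<alpha>)\<close>. The zeroth order term is harmless because \<open>0 \<le> u z - v z \<le> b z\<close>. First \<open>\<alpha>\<close> is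
chosen large, then \<open>\<epsilon>\<close> small, so that the increments stay in the unit ball and the compact set does not
depend on \<open>\<alpha>\<close>.

\<open>F\<close> is differentiated only along symmetric matrices, so the Hessian of \<open>v\<close> must be known to be
symmetric; \<open>hessian_symmetric\<close> proves this theorem of Schwarz.\<close>

section \<open>Gradients and Hessians\<close>

lemma gradient_has_derivative:
  fixes f :: "real^'n \<Rightarrow> real"
  assumes "f differentiable at x"
  shows "(f has_derivative (\<lambda>d. gradient f x \<bullet> d)) (at x)"
proof -
  let ?f' = "frechet_derivative f (at x)"
  have lin: "linear ?f'"
    using assms by (rule linear_frechet_derivative)
  have "?f' d = gradient f x \<bullet> d" for d
  proof -
    have "?f' d = ?f' (\<Sum>i\<in>UNIV. d $ i *\<^sub>R axis i 1)"
      using basis_expansion[of d] by (simp add: scalar_mult_eq_scaleR)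
    also have "\<dots> = (\<Sum>i\<in>UNIV. d $ i * ?f' (axis i 1))"
      using lin by (simp add: linear_sum linear_cmul)
    finally show ?thesis
      by (simp add: gradient_def inner_vec_def mult.commute)
  qed
  then have "?f' = (\<lambda>d. gradient f x \<bullet> d)" by auto
  then show ?thesis
    using assms frechet_derivative_works by metis
qed

lemma gradient_eqI:
  fixes f :: "real^'n \<Rightarrow> real"
  assumes "(f has_derivative (\<lambda>d. g \<bullet> d)) (at x)"
  shows "gradient f x = g"
  using frechet_derivative_at[OF assms, symmetric]
  by (simp add: gradient_def vec_eq_iff inner_axis)

lemma hessian_has_derivative:
  fixes f :: "real^'n \<Rightarrow> real"
  assumes "gradient f differentiable at x"
  shows "(gradient f has_derivative (\<lambda>d. hessian f x *v d)) (at x)"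
  using assms jacobian_works unfolding hessian_def by blast

lemma hessian_eqI:
  fixes f :: "real^'n \<Rightarrow> real"
  assumes "(gradient f has_derivative (\<lambda>d. A *v d)) (at x)"
  shows "hessian f x = A"
  using frechet_derivative_at[OF assms, symmetric]
  by (simp add: hessian_def jacobian_def)

lemma
  fixes f k :: "real^'n \<Rightarrow> real"
  assumes "open U" and f: "C2_on U f" and k: "C2_on U k"
  shows C2_on_add: "C2_on U (\<lambda>x. f x + k x)"
    and gradient_add: "x \<in> U \<Longrightarrow> gradient (\<lambda>x. f x + k x) x = gradient f x + gradient k x"
    and hessian_add: "x \<in> U \<Longrightarrow> hessian (\<lambda>x. f x + k x) x = hessian f x + hessian k x"
proof -
  let ?s = "\<lambda>x. f x + k x"
  have grad: "gradient ?s x = gradient f x + gradient k x" if "x \<in> U" for x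
    using that f k unfolding C2_on_def
    by (intro gradient_eqI)
       (auto simp: inner_add_left intro!: has_derivative_add gradient_has_derivative)
  have deriv: "(gradient ?s has_derivative (\<lambda>d. (hessian f x + hessian k x) *v d)) (at x)"
    if "x \<in> U" for x
  proof (rule has_derivative_transform_within_open[OF _ \<open>open U\<close> that])
    show "((\<lambda>x. gradient f x + gradient k x) has_derivative
            (\<lambda>d. (hessian f x + hessian k x) *v d)) (at x)"
      using that f k unfolding C2_on_def
      by (auto simp: matrix_vector_mult_add_rdistrib
          intro!: has_derivative_add hessian_has_derivative)
  qed (simp add: grad)
  have hess: "hessian ?s x = hessian f x + hessian k x" if "x \<in> U" for x
    using deriv[OF that] by (rule hessian_eqI)
  have "continuous_on U (hessian ?s)"
    using f k by (subst continuous_on_cong[OF refl hess])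
      (auto simp: C2_on_def intro!: continuous_intros)
  moreover have "gradient ?s differentiable at x" if "x \<in> U" for x
    using deriv[OF that] by (rule differentiableI)
  ultimately show "C2_on U ?s"
    using f k unfolding C2_on_def by (auto intro: differentiable_add)
  show "gradient ?s x = gradient f x + gradient k x" if "x \<in> U"
    using that by (rule grad)
  show "hessian ?s x = hessian f x + hessian k x" if "x \<in> U"
    using that by (rule hess)
qed

lemma has_derivative_along_line:
  fixes f :: "real^'n \<Rightarrow> real"
  assumes "f differentiable at (x + t *\<^sub>R d)"
  shows "((\<lambda>t. f (x + t *\<^sub>R d)) has_real_derivative gradient f (x + t *\<^sub>R d) \<bullet> d) (at t)"
proof -
  have "((\<lambda>t. x + t *\<^sub>R d) has_derivative (\<lambda>t. t *\<^sub>R d)) (at t)"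
    by (auto intro!: derivative_eq_intros)
  from has_derivative_compose[OF this gradient_has_derivative[OF assms]]
  show ?thesis
    by (rule has_derivative_imp_has_field_derivative) (simp add: mult.commute)
qed

definition second_difference :: "(real^'n \<Rightarrow> real) \<Rightarrow> real^'n \<Rightarrow> real^'n \<Rightarrow> real^'n \<Rightarrow> real" where
  "second_difference f x a b = f (x + a + b) - f (x + a) - f (x + b) + f x"

text \<open>The difference is \<open>\<psi> 1 - \<psi> 0\<close> for \<open>\<psi> \<tau> = f (x + t a + \<tau> t b) - f (x + \<tau> t b)\<close>. The mean value theorem in
\<open>\<tau>\<close> turns it into a difference of gradients at two points at distance \<open>O(t)\<close> from \<open>x\<close>, and the
differentiability of the gradient at \<open>x\<close> evaluates that difference up to \<open>o(t)\<close>.\<close>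

lemma second_difference_asymp:
  fixes f :: "real^'n \<Rightarrow> real"
  assumes "open U" "x \<in> U" and f: "\<And>z. z \<in> U \<Longrightarrow> f differentiable at z"
    and g: "gradient f differentiable at x" and "0 < e"
  shows "\<forall>\<^sub>F t in at_right 0.
           \<bar>second_difference f x (t *\<^sub>R a) (t *\<^sub>R b) - t\<^sup>2 * (b \<bullet> (hessian f x *v a))\<bar> \<le> e * t\<^sup>2"
proof -
  let ?A = "hessian f x"
  define c where "c = norm a + norm b + 1"
  have c: "c > 0" unfolding c_def by (smt (verit) norm_ge_zero)
  \<comment> \<open>The linearisation error enters twice, each time at distance at most \<open>t c\<close> and paired with
    \<open>b\<close>, so \<open>\<eta>\<close> costs \<open>2 \<eta> c\<^sup>2 t\<^sup>2\<close> in the end.\<close>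
  define \<eta> where "\<eta> = e / (2 * c\<^sup>2)"
  have \<eta>: "\<eta> > 0" using c \<open>0 < e\<close> by (simp add: \<eta>_def)
  obtain r where r: "r > 0" "ball x r \<subseteq> U"
    using assms(1,2) open_contains_ball by blast
  obtain r' where r': "r' > 0" and
    lin: "\<And>z. norm (z - x) < r' \<Longrightarrow>
            norm (gradient f z - gradient f x - ?A *v (z - x)) \<le> \<eta> * norm (z - x)"
    using hessian_has_derivative[OF g] \<eta> unfolding has_derivative_at_alt by blast
  have "\<bar>second_difference f x (t *\<^sub>R a) (t *\<^sub>R b) - t\<^sup>2 * (b \<bullet> (?A *v a))\<bar> \<le> e * t\<^sup>2"
    if t: "0 < t" "t < min r r' / c" for t
  proof -
    have tc: "t * c < r" "t * c < r'"
      using t(2) c by (simp_all add: pos_less_divide_eq)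
    have small: "norm (\<alpha> *\<^sub>R t *\<^sub>R a + \<beta> *\<^sub>R t *\<^sub>R b) \<le> t * c" if "0 \<le> \<alpha>" "\<alpha> \<le> 1" "0 \<le> \<beta>" "\<beta> \<le> 1" for \<alpha> \<beta>
    proof -
      have "norm (\<alpha> *\<^sub>R t *\<^sub>R a + \<beta> *\<^sub>R t *\<^sub>R b) \<le> \<alpha> * (t * norm a) + \<beta> * (t * norm b)"
        using that t(1) by (intro norm_triangle_le) (simp add: abs_mult)
      also have "\<dots> \<le> 1 * (t * norm a) + 1 * (t * norm b)"
        using that t(1) by (intro add_mono mult_right_mono) auto
      also have "\<dots> \<le> t * c" using t(1) by (simp add: c_def algebra_simps)
      finally show ?thesis .
    qed
    have inU: "x + \<alpha> *\<^sub>R t *\<^sub>R a + \<beta> *\<^sub>R t *\<^sub>R b \<in> U" if "0 \<le> \<alpha>" "\<alpha> \<le> 1" "0 \<le> \<beta>" "\<beta> \<le> 1" for \<alpha> \<beta>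
    proof -
      have "dist x (x + \<alpha> *\<^sub>R t *\<^sub>R a + \<beta> *\<^sub>R t *\<^sub>R b) = norm (\<alpha> *\<^sub>R t *\<^sub>R a + \<beta> *\<^sub>R t *\<^sub>R b)"
        by (metis add.assoc add_diff_cancel_left' dist_commute dist_norm)
      then show ?thesis using small[OF that] tc r(2) by (auto simp: mem_ball)
    qed
    let ?\<psi> = "\<lambda>\<tau>. f ((x + t *\<^sub>R a) + \<tau> *\<^sub>R t *\<^sub>R b) - f (x + \<tau> *\<^sub>R t *\<^sub>R b)"
    let ?\<psi>' = "\<lambda>\<tau>. gradient f ((x + t *\<^sub>R a) + \<tau> *\<^sub>R t *\<^sub>R b) \<bullet> (t *\<^sub>R b) - gradient f (x + \<tau> *\<^sub>R t *\<^sub>R b) \<bullet> (t *\<^sub>R b)"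
    have "\<exists>\<tau>>0. \<tau> < 1 \<and> ?\<psi> 1 - ?\<psi> 0 = (1 - 0) * ?\<psi>' \<tau>"
    proof (rule MVT2[of 0 1 ?\<psi> ?\<psi>'])
      fix \<tau> :: real assume \<tau>: "0 \<le> \<tau>" "\<tau> \<le> 1"
      show "(?\<psi> has_real_derivative ?\<psi>' \<tau>) (at \<tau>)"
        using inU[of 1 \<tau>] inU[of 0 \<tau>] \<tau>
        by (intro DERIV_diff has_derivative_along_line f) auto
    qed simp
    then obtain \<tau> where \<tau>: "0 < \<tau>" "\<tau> < 1" and eq: "?\<psi> 1 - ?\<psi> 0 = ?\<psi>' \<tau>" by auto
    define z1 where "z1 = x + t *\<^sub>R a + \<tau> *\<^sub>R t *\<^sub>R b"
    define z0 where "z0 = x + \<tau> *\<^sub>R t *\<^sub>R b"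
    define R1 where "R1 = gradient f z1 - gradient f x - ?A *v (z1 - x)"
    define R0 where "R0 = gradient f z0 - gradient f x - ?A *v (z0 - x)"
    have n1: "norm (z1 - x) \<le> t * c" and n0: "norm (z0 - x) \<le> t * c"
      using small[of 1 \<tau>] small[of 0 \<tau>] \<tau> by (auto simp: z1_def z0_def)
    have R: "norm R1 \<le> \<eta> * (t * c)" "norm R0 \<le> \<eta> * (t * c)"
      using lin[of z1] lin[of z0] n1 n0 tc \<eta> unfolding R1_def R0_def
      by (smt (verit) mult_left_mono)+
    have dz: "z1 - z0 = t *\<^sub>R a" by (simp add: z1_def z0_def)
    have "gradient f z1 - gradient f z0 = ?A *v ((z1 - x) - (z0 - x)) + (R1 - R0)"
      unfolding R1_def R0_def by (simp only: matrix_vector_mult_diff_distrib) (simp add: algebra_simps)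
    then have gd: "gradient f z1 - gradient f z0 = t *\<^sub>R (?A *v a) + (R1 - R0)"
      using dz by (simp add: matrix_vector_mult_scaleR)
    have "second_difference f x (t *\<^sub>R a) (t *\<^sub>R b) = (gradient f z1 - gradient f z0) \<bullet> (t *\<^sub>R b)"
      using eq by (simp add: second_difference_def z1_def z0_def inner_diff_left right_diff_distrib)
    also have "\<dots> = t\<^sup>2 * (b \<bullet> (?A *v a)) + t * ((R1 - R0) \<bullet> b)"
      unfolding gd by (simp add: inner_add_left power2_eq_square inner_commute[of b] distrib_left)
    finally have "\<bar>second_difference f x (t *\<^sub>R a) (t *\<^sub>R b) - t\<^sup>2 * (b \<bullet> (?A *v a))\<bar>
                    = t * \<bar>(R1 - R0) \<bullet> b\<bar>"
      using t(1) by (simp add: abs_mult)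
    also have "\<dots> \<le> t * ((2 * (\<eta> * (t * c))) * c)"
    proof (rule mult_left_mono)
      have "\<bar>(R1 - R0) \<bullet> b\<bar> \<le> norm (R1 - R0) * norm b" by (rule Cauchy_Schwarz_ineq2)
      also have "\<dots> \<le> (2 * (\<eta> * (t * c))) * c"
      proof (rule mult_mono)
        show "norm (R1 - R0) \<le> 2 * (\<eta> * (t * c))"
          using R norm_triangle_ineq4[of R1 R0] by linarith
        show "norm b \<le> c"
          by (simp add: c_def)
        show "0 \<le> 2 * (\<eta> * (t * c))"
          using \<eta> c t(1) by simp
      qed simp
      finally show "\<bar>(R1 - R0) \<bullet> b\<bar> \<le> (2 * (\<eta> * (t * c))) * c" .
    qed (use t(1) in simp)
    also have "\<dots> = e * t\<^sup>2"
      using c by (simp add: \<eta>_def power2_eq_square)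
    finally show ?thesis .
  qed
  moreover have "min r r' / c > 0"
    using r(1) r' c by simp
  ultimately show ?thesis
    by (intro eventually_at_rightI[of 0 "min r r' / c"]) (simp_all only: greaterThanLessThan_iff)
qed


text \<open>The second difference is symmetric in the two directions, so its two expansions
\<open>t\<^sup>2 (b \<bullet> H a) + o(t\<^sup>2)\<close> and \<open>t\<^sup>2 (a \<bullet> H b) + o(t\<^sup>2)\<close> must agree.\<close>

lemma hessian_symmetric:
  fixes f :: "real^'n \<Rightarrow> real"
  assumes "open U" "C2_on U f" "x \<in> U"
  shows "hessian f x \<in> sym_matrices"
proof -
  let ?A = "hessian f x"
  have sym: "b \<bullet> (?A *v a) = a \<bullet> (?A *v b)" for a b
  proof -
    have "\<bar>b \<bullet> (?A *v a) - a \<bullet> (?A *v b)\<bar> \<le> 2 * e" if "0 < e" for e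
    proof -
      have "\<forall>\<^sub>F t in at_right 0. \<bar>second_difference f x (t *\<^sub>R a) (t *\<^sub>R b) - t\<^sup>2 * (b \<bullet> (?A *v a))\<bar> \<le> e * t\<^sup>2"
           "\<forall>\<^sub>F t in at_right 0. \<bar>second_difference f x (t *\<^sub>R b) (t *\<^sub>R a) - t\<^sup>2 * (a \<bullet> (?A *v b))\<bar> \<le> e * t\<^sup>2"
        using assms that by (intro second_difference_asymp[of U]; auto simp: C2_on_def)+
      with eventually_at_right_less[of "0::real"]
      have "\<forall>\<^sub>F t in at_right (0::real). \<bar>b \<bullet> (?A *v a) - a \<bullet> (?A *v b)\<bar> \<le> 2 * e"
      proof eventually_elim
        case (elim t)
        have "second_difference f x (t *\<^sub>R b) (t *\<^sub>R a) = second_difference f x (t *\<^sub>R a) (t *\<^sub>R b)"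
          by (simp add: second_difference_def add.commute add.left_commute)
        with elim have "\<bar>t\<^sup>2 * (b \<bullet> (?A *v a)) - t\<^sup>2 * (a \<bullet> (?A *v b))\<bar> \<le> 2 * (e * t\<^sup>2)" by linarith
        then have "t\<^sup>2 * \<bar>b \<bullet> (?A *v a) - a \<bullet> (?A *v b)\<bar> \<le> t\<^sup>2 * (2 * e)"
          by (simp add: right_diff_distrib[symmetric] abs_mult mult_ac)
        with elim show ?case by simp
      qed
      then show ?thesis by simp
    qed
    from this[of "\<bar>b \<bullet> (?A *v a) - a \<bullet> (?A *v b)\<bar> / 4"] show ?thesis by auto
  qed
  have entry: "axis i 1 \<bullet> (?A *v axis j 1) = ?A $ i $ j" for i j
    by (simp add: inner_axis' matrix_vector_mul_component inner_axis)
  have "?A $ j $ i = ?A $ i $ j" for i j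
    using sym[of "axis j 1" "axis i 1"] by (simp only: entry)
  then show ?thesis
    by (simp add: sym_matrices_def transpose_def vec_eq_iff)
qed

section \<open>A mean value formula for the nonlinearity\<close>

text \<open>The partial derivatives of \<open>F\<close> are given along finitely many directions that span
\<open>L = \<real> \<times> \<real>\<^sup>n \<times> sym_matrices\<close>, and nothing is known of \<open>F\<close> outside this subspace. Continuity of the
derivative on \<open>L\<close> is part of the notion because it makes directional derivatives additive in the direction
(\<open>directional_derivative_add\<close>), so that derivatives along arbitrary directions can be
assembled from the partial ones.\<close>

definition has_directional_derivative_on ::
  "('a::real_normed_vector \<Rightarrow> real) \<Rightarrow> 'a \<Rightarrow> ('a \<Rightarrow> real) \<Rightarrow> 'a set \<Rightarrow> bool" where
  "has_directional_derivative_on f d D L \<longleftrightarrow>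
     d \<in> L \<and> continuous_on L D \<and>
     (\<forall>z\<in>L. ((\<lambda>t. f (z + t *\<^sub>R d)) has_real_derivative D z) (at 0))"

lemma directional_derivative_along_line:
  assumes L: "subspace L" and d: "has_directional_derivative_on f d D L" and z: "z \<in> L"
  shows "((\<lambda>t. f (z + t *\<^sub>R d)) has_real_derivative D (z + \<tau> *\<^sub>R d)) (at \<tau>)"
proof -
  have "z + \<tau> *\<^sub>R d \<in> L"
    using L d z by (simp add: has_directional_derivative_on_def subspace_add subspace_scale)
  then have "((\<lambda>t. f (z + \<tau> *\<^sub>R d + t *\<^sub>R d)) has_real_derivative D (z + \<tau> *\<^sub>R d)) (at 0)"
    using d by (simp add: has_directional_derivative_on_def)
  then have "((\<lambda>t. f (z + (t + \<tau>) *\<^sub>R d)) has_real_derivative D (z + \<tau> *\<^sub>R d)) (at 0)"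
    by (simp add: algebra_simps)
  then show ?thesis
    using DERIV_shift[of "\<lambda>t. f (z + t *\<^sub>R d)" "D (z + \<tau> *\<^sub>R d)" 0 \<tau>] by simp
qed

lemma directional_mean_value:
  assumes "subspace L" "has_directional_derivative_on f d D L" "z \<in> L"
  obtains \<theta> where "0 < \<theta>" "\<theta> < 1" "f (z + t *\<^sub>R d) - f z = t * D (z + (\<theta> * t) *\<^sub>R d)"
proof -
  have "((\<lambda>\<tau>. f (z + (\<tau> * t) *\<^sub>R d)) has_real_derivative D (z + (\<tau> * t) *\<^sub>R d) * t) (at \<tau>)" for \<tau>
    by (rule DERIV_chain2[where g = "\<lambda>\<tau>. \<tau> * t", OF directional_derivative_along_line[OF assms]])
       (auto intro!: derivative_eq_intros)
  then obtain \<theta> where "0 < \<theta>" "\<theta> < 1" and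
    "f (z + (1 * t) *\<^sub>R d) - f (z + (0 * t) *\<^sub>R d) = (1 - 0) * (D (z + (\<theta> * t) *\<^sub>R d) * t)"
    using MVT2[of 0 1 "\<lambda>\<tau>. f (z + (\<tau> * t) *\<^sub>R d)" "\<lambda>\<tau>. D (z + (\<tau> * t) *\<^sub>R d) * t"] by auto
  then show thesis
    by (intro that[of \<theta>]) auto
qed

lemma directional_derivative_zero:
  assumes "subspace L"
  shows "has_directional_derivative_on f 0 (\<lambda>_. 0) L"
  using assms by (simp add: has_directional_derivative_on_def subspace_0)

lemma directional_derivative_scale:
  assumes L: "subspace L" and d: "has_directional_derivative_on f d D L"
  shows "has_directional_derivative_on f (c *\<^sub>R d) (\<lambda>z. c * D z) L"
proof -
  have "((\<lambda>t. f (z + t *\<^sub>R c *\<^sub>R d)) has_real_derivative c * D z) (at 0)" if "z \<in> L" for z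
  proof -
    have "((\<lambda>t. f (z + (t * c) *\<^sub>R d)) has_real_derivative D (z + (0 * c) *\<^sub>R d) * c) (at 0)"
      by (rule DERIV_chain2[where g = "\<lambda>t. t * c", OF directional_derivative_along_line[OF L d that]])
         (auto intro!: derivative_eq_intros)
    then show ?thesis by (simp add: mult.commute)
  qed
  then show ?thesis
    using L d by (auto simp: has_directional_derivative_on_def subspace_scale intro!: continuous_intros)
qed

text \<open>Move along \<open>a\<close> first and then along \<open>b\<close>. The second increment is \<open>t\<close> times \<open>Db\<close> at an intermediate point,
which tends to \<open>z\<close>; continuity of \<open>Db\<close> gives the limit.\<close>

lemma directional_derivative_add:
  assumes L: "subspace L"
    and a: "has_directional_derivative_on f a Da L"
    and b: "has_directional_derivative_on f b Db L"
  shows "has_directional_derivative_on f (a + b) (\<lambda>z. Da z + Db z) L"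
proof -
  have aL: "a \<in> L" and bL: "b \<in> L" and cont: "continuous_on L Da" "continuous_on L Db"
    using a b by (auto simp: has_directional_derivative_on_def)
  have "((\<lambda>t. f (z + t *\<^sub>R (a + b))) has_real_derivative Da z + Db z) (at 0)" if z: "z \<in> L" for z
  proof -
    have "\<exists>\<theta>. 0 < \<theta> \<and> \<theta> < 1 \<and>
        f (z + t *\<^sub>R a + t *\<^sub>R b) - f (z + t *\<^sub>R a) = t * Db (z + t *\<^sub>R a + (\<theta> * t) *\<^sub>R b)" for t
      using L z aL directional_mean_value[OF L b, of "z + t *\<^sub>R a" t]
      by (metis subspace_add subspace_scale)
    then obtain \<theta> where \<theta>: "0 < \<theta> t" "\<theta> t < 1"
      "f (z + t *\<^sub>R a + t *\<^sub>R b) - f (z + t *\<^sub>R a) = t * Db (z + t *\<^sub>R a + (\<theta> t * t) *\<^sub>R b)" for t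
      by metis
    let ?\<zeta> = "\<lambda>t. z + t *\<^sub>R a + (\<theta> t * t) *\<^sub>R b"
    have "(\<lambda>t. \<theta> t * t) \<midarrow>0\<rightarrow> 0"
    proof (rule Lim_null_comparison)
      show "\<forall>\<^sub>F t in at 0. norm (\<theta> t * t) \<le> \<bar>t\<bar>"
        using \<theta>(1,2) by (intro always_eventually) (simp add: abs_mult mult_left_le_one_le less_imp_le abs_of_pos)
      show "((\<lambda>t::real. \<bar>t\<bar>) \<midarrow>0\<rightarrow> 0)"
        by (rule tendsto_eq_intros) (auto intro!: tendsto_eq_intros)
    qed
    then have "?\<zeta> \<midarrow>0\<rightarrow> z + 0 *\<^sub>R a + 0 *\<^sub>R b"
      by (intro tendsto_intros) auto
    then have "?\<zeta> \<midarrow>0\<rightarrow> z" by simp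
    moreover have "?\<zeta> t \<in> L" for t
      using L z aL bL by (intro subspace_add subspace_scale)
    ultimately have "(\<lambda>t. Db (?\<zeta> t)) \<midarrow>0\<rightarrow> Db z"
      using z by (intro continuous_on_tendsto_compose[OF cont(2)]) auto
    moreover have "(\<lambda>t. (f (z + t *\<^sub>R a) - f z) / t) \<midarrow>0\<rightarrow> Da z"
      using a z by (auto simp: has_directional_derivative_on_def DERIV_def)
    ultimately have "(\<lambda>t. (f (z + t *\<^sub>R a) - f z) / t + Db (?\<zeta> t)) \<midarrow>0\<rightarrow> Da z + Db z"
      by (intro tendsto_add)
    moreover have "\<forall>\<^sub>F t in at 0.
        (f (z + t *\<^sub>R a) - f z) / t + Db (?\<zeta> t) = (f (z + t *\<^sub>R (a + b)) - f z) / t"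
      unfolding eventually_at_filter
    proof (intro always_eventually allI impI)
      fix t :: real assume "t \<noteq> 0"
      have "f (z + t *\<^sub>R (a + b)) = f (z + t *\<^sub>R a) + t * Db (?\<zeta> t)"
        using \<theta>(3)[of t] by (simp add: scaleR_add_right add.assoc)
      then show "(f (z + t *\<^sub>R a) - f z) / t + Db (?\<zeta> t) = (f (z + t *\<^sub>R (a + b)) - f z) / t"
        using \<open>t \<noteq> 0\<close> by (simp add: field_simps)
    qed
    ultimately have "(\<lambda>t. (f (z + t *\<^sub>R (a + b)) - f z) / t) \<midarrow>0\<rightarrow> Da z + Db z"
      by (rule Lim_transform_eventually)
    then show ?thesis by (simp add: DERIV_def)
  qed
  then show ?thesis
    using L aL bL cont
    by (auto simp: has_directional_derivative_on_def subspace_add intro!: continuous_intros)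
qed

lemma directional_derivative_sum:
  assumes L: "subspace L" and "finite I"
    and "\<And>i. i \<in> I \<Longrightarrow> has_directional_derivative_on f (e i) (D i) L"
  shows "has_directional_derivative_on f (\<Sum>i\<in>I. e i) (\<lambda>z. \<Sum>i\<in>I. D i z) L"
  using assms(2,3)
  by (induction I rule: finite_induct)
     (simp_all add: directional_derivative_zero[OF L] directional_derivative_add[OF L])

lemma subspace_sym_matrices: "subspace (sym_matrices :: (real^'n^'n) set)"
  by (auto simp: subspace_def sym_matrices_def transpose_def vec_eq_iff)

lemma sym_matrix_expansion:
  fixes N :: "real^'n::finite^'n"
  assumes "N \<in> sym_matrices"
  shows "N = (\<Sum>i\<in>UNIV. \<Sum>j\<in>UNIV. N $ i $ j *\<^sub>R sym_unit i j)"
proof -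
  have N: "N $ l $ k = N $ k $ l" for k l
    using assms by (simp add: sym_matrices_def transpose_def vec_eq_iff)
  have "(\<Sum>i\<in>UNIV. \<Sum>j\<in>UNIV. N $ i $ j * (sym_unit i j $ k $ l)) = N $ k $ l" for k l
  proof -
    have "(\<Sum>i\<in>UNIV. \<Sum>j\<in>UNIV. N $ i $ j * (sym_unit i j $ k $ l))
        = (\<Sum>i\<in>UNIV. \<Sum>j\<in>UNIV. if i = k then if j = l then N $ k $ l / 2 else 0 else 0)
          + (\<Sum>i\<in>UNIV. \<Sum>j\<in>UNIV. if i = l then if j = k then N $ l $ k / 2 else 0 else 0)"
      unfolding sum.distrib[symmetric]
      by (intro sum.cong refl) (auto simp: sym_unit_def)
    also have "\<dots> = (\<Sum>i\<in>UNIV. if i = k then N $ k $ l / 2 else 0) + (\<Sum>i\<in>UNIV. if i = l then N $ l $ k / 2 else 0)"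
      by (intro arg_cong2[where f = "(+)"] sum.cong refl) (auto simp: sum.delta)
    also have "\<dots> = N $ k $ l"
      by (simp add: N[of l k])
    finally show ?thesis .
  qed
  then show ?thesis
    by (simp add: vec_eq_iff sum_component)
qed

lemma sym_unit_in_sym_matrices: "sym_unit i j \<in> sym_matrices"
  by (simp add: sym_matrices_def sym_unit_def transpose_def add.commute conj_commute)

text \<open>The increment \<open>(\<sigma>, q, N)\<close> is expanded in the unit vectors and the \<open>sym_unit i j\<close>, and the partial
derivatives are added up. It matters that all three derivatives are taken at the same point of the segment:
positive definiteness can only be applied to the matrix of derivatives at a single argument.\<close>

lemma nonlinearity_mean_value:
  fixes F :: "'n::finite nonlinearity"
  assumes C1: "C1_in_spM X F" and x: "x \<in> X" and M: "M \<in> sym_matrices" and N: "N \<in> sym_matrices"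
  obtains \<theta> where "0 < \<theta>" "\<theta> < 1"
    "F x (s + \<sigma>) (p + q) (M + N) - F x s p M =
       partial_s F x (s + \<theta> * \<sigma>) (p + \<theta> *\<^sub>R q) (M + \<theta> *\<^sub>R N) * \<sigma>
       + partial_p F x (s + \<theta> * \<sigma>) (p + \<theta> *\<^sub>R q) (M + \<theta> *\<^sub>R N) \<bullet> q
       + partial_M F x (s + \<theta> * \<sigma>) (p + \<theta> *\<^sub>R q) (M + \<theta> *\<^sub>R N) \<bullet> N"
proof -
  define L where "L = (UNIV :: real set) \<times> (UNIV :: (real^'n) set) \<times> (sym_matrices :: (real^'n^'n) set)"
  define f where "f = (\<lambda>(s, p, M). F x s p M)"
  define Ds where "Ds = (\<lambda>(s, p, M). partial_s F x s p M)"
  define Dp where "Dp = (\<lambda>(s, p, M). partial_p F x s p M)"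
  define DM where "DM = (\<lambda>(s, p, M). partial_M F x s p M)"
  have L: "subspace L"
    unfolding L_def by (intro subspace_Times subspace_UNIV subspace_sym_matrices)
  have slice: "continuous_on L (\<lambda>z. G (x, z))"
    if "continuous_on (X \<times> UNIV \<times> UNIV \<times> sym_matrices) G" for G :: "_ \<Rightarrow> 'b::topological_space"
    by (rule continuous_on_compose2[OF that]) (use x in \<open>auto simp: L_def intro!: continuous_intros\<close>)
  have cont: "continuous_on L Ds" "continuous_on L Dp" "continuous_on L DM"
    using C1 slice[of "\<lambda>(x, s, p, M). partial_s F x s p M"]
      slice[of "\<lambda>(x, s, p, M). partial_p F x s p M"]
      slice[of "\<lambda>(x, s, p, M). partial_M F x s p M"]
    by (simp_all add: C1_in_spM_def Ds_def Dp_def DM_def case_prod_unfold)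
  have s_dir: "has_directional_derivative_on f (1, 0, 0) Ds L"
  proof -
    have "((\<lambda>t. F x (s + t) p M) has_real_derivative partial_s F x s p M) (at 0)"
      if "M \<in> sym_matrices" for s p M
    proof -
      have "((\<lambda>t. F x t p M) has_real_derivative partial_s F x s p M) (at (0 + s))"
        using C1 x that by (simp add: C1_in_spM_def partial_s_def DERIV_deriv_iff_field_differentiable)
      then show ?thesis
        unfolding DERIV_shift by (simp add: add.commute)
    qed
    then show ?thesis
      using cont by (auto simp: has_directional_derivative_on_def L_def f_def Ds_def
          subspace_0[OF subspace_sym_matrices])
  qed
  have p_dir: "has_directional_derivative_on f (0, axis i 1, 0) (\<lambda>z. Dp z $ i) L" for i
    using C1 x cont(2)
    by (auto simp: has_directional_derivative_on_def L_def f_def Dp_def C1_in_spM_def partial_p_def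
        DERIV_deriv_iff_field_differentiable subspace_0[OF subspace_sym_matrices]
        intro: continuous_on_component)
  have M_dir: "has_directional_derivative_on f (0, 0, sym_unit i j) (\<lambda>z. DM z $ i $ j) L" for i j
    using C1 x cont(3)
    by (auto simp: has_directional_derivative_on_def L_def f_def DM_def C1_in_spM_def partial_M_def
        DERIV_deriv_iff_field_differentiable sym_unit_in_sym_matrices
        intro!: continuous_on_component)
  have "has_directional_derivative_on f
      (\<sigma> *\<^sub>R (1, 0, 0) + (\<Sum>i\<in>UNIV. q $ i *\<^sub>R (0, axis i 1, 0))
        + (\<Sum>i\<in>UNIV. \<Sum>j\<in>UNIV. N $ i $ j *\<^sub>R (0, 0, sym_unit i j)))
      (\<lambda>z. \<sigma> * Ds z + (\<Sum>i\<in>UNIV. q $ i * Dp z $ i) + (\<Sum>i\<in>UNIV. \<Sum>j\<in>UNIV. N $ i $ j * DM z $ i $ j)) L"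
    by (intro directional_derivative_add[OF L] directional_derivative_sum[OF L]
        directional_derivative_scale[OF L] s_dir p_dir M_dir) auto
  moreover have "\<sigma> *\<^sub>R (1, 0, 0) + (\<Sum>i\<in>UNIV. q $ i *\<^sub>R (0, axis i 1, 0))
        + (\<Sum>i\<in>UNIV. \<Sum>j\<in>UNIV. N $ i $ j *\<^sub>R (0, 0, sym_unit i j)) = (\<sigma>, q, N)"
  proof -
    have "(\<Sum>i\<in>UNIV. q $ i *\<^sub>R axis i 1) = q"
      using basis_expansion[of q] by (simp add: scalar_mult_eq_scaleR)
    moreover have "(\<Sum>i\<in>UNIV. \<Sum>j\<in>UNIV. N $ i $ j *\<^sub>R sym_unit i j) = N"
      using sym_matrix_expansion[OF N] by simp
    ultimately show ?thesis
      by (simp add: prod_eq_iff fst_sum snd_sum)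
  qed
  ultimately have "has_directional_derivative_on f (\<sigma>, q, N)
      (\<lambda>z. \<sigma> * Ds z + (\<Sum>i\<in>UNIV. q $ i * Dp z $ i) + (\<Sum>i\<in>UNIV. \<Sum>j\<in>UNIV. N $ i $ j * DM z $ i $ j)) L"
    by simp
  then have dir: "has_directional_derivative_on f (\<sigma>, q, N) (\<lambda>z. Ds z * \<sigma> + Dp z \<bullet> q + DM z \<bullet> N) L"
    by (simp add: inner_vec_def mult.commute)
  obtain \<theta> where "0 < \<theta>" "\<theta> < 1"
    "f ((s, p, M) + 1 *\<^sub>R (\<sigma>, q, N)) - f (s, p, M) =
      1 * (Ds ((s, p, M) + (\<theta> * 1) *\<^sub>R (\<sigma>, q, N)) * \<sigma> + Dp ((s, p, M) + (\<theta> * 1) *\<^sub>R (\<sigma>, q, N)) \<bullet> q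
        + DM ((s, p, M) + (\<theta> * 1) *\<^sub>R (\<sigma>, q, N)) \<bullet> N)"
    by (rule directional_mean_value[OF L dir, of "(s, p, M)" 1]) (use M in \<open>auto simp: L_def\<close>)
  then show thesis
    by (intro that[of \<theta>]) (auto simp: f_def Ds_def Dp_def DM_def)
qed

section \<open>Minima of lower semicontinuous functions\<close>

lemma lsc_on_subset: "lsc_on S w \<Longrightarrow> T \<subseteq> S \<Longrightarrow> lsc_on T w"
  unfolding lsc_on_def by (meson at_le filter_leD subsetD)

lemma lsc_on_add_continuous:
  assumes u: "lsc_on S u" and k: "continuous_on S k"
  shows "lsc_on S (\<lambda>x. u x + k x)"
  unfolding lsc_on_def
proof (intro ballI allI impI)
  fix x c assume x: "x \<in> S" and c: "c < u x + k x"
  define e where "e = (u x + k x - c) / 2"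
  have e: "e > 0" using c by (simp add: e_def)
  have "\<forall>\<^sub>F y in at x within S. u x - e < u y"
    using u x e unfolding lsc_on_def by simp
  moreover have "(k \<longlongrightarrow> k x) (at x within S)"
    using k x by (simp add: continuous_on_def)
  then have "\<forall>\<^sub>F y in at x within S. k x - e < k y"
    using e by (intro order_tendstoD) auto
  ultimately show "\<forall>\<^sub>F y in at x within S. c < u y + k y"
    by eventually_elim (simp add: e_def field_simps)
qed

text \<open>If no point were minimal, each \<open>x\<close> would have a neighbourhood on which \<open>w\<close> exceeds the value at some other
point \<open>b x\<close>. Among the finitely many \<open>b x\<close> of a finite subcover, the one with the smallest value lies in
one of the neighbourhoods, a contradiction.\<close>

lemma lsc_attains_inf:
  fixes w :: "'a::topological_space \<Rightarrow> real"
  assumes "compact S" "S \<noteq> {}" and w: "lsc_on S w"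
  obtains x where "x \<in> S" "\<And>y. y \<in> S \<Longrightarrow> w x \<le> w y"
proof -
  have "\<exists>x\<in>S. \<forall>y\<in>S. w x \<le> w y"
  proof (rule ccontr)
    assume "\<not> ?thesis"
    then have "\<exists>y\<in>S. w y < w x" if "x \<in> S" for x
      using that by (meson not_le)
    then obtain b where b: "b x \<in> S" "w (b x) < w x" if "x \<in> S" for x
      by metis
    have "\<exists>V. open V \<and> x \<in> V \<and> (\<forall>y\<in>S \<inter> V. w (b x) < w y)" if x: "x \<in> S" for x
    proof -
      have "\<forall>\<^sub>F y in at x within S. w (b x) < w y"
        using w x b[OF x] unfolding lsc_on_def by blast
      then obtain V where "open V" "x \<in> V" "\<forall>y\<in>V. y \<noteq> x \<longrightarrow> y \<in> S \<longrightarrow> w (b x) < w y"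
        unfolding eventually_at_topological by blast
      then show ?thesis using b(2)[OF x] by (intro exI[of _ V]) (metis IntD1 IntD2)
    qed
    then obtain V where V: "\<forall>x\<in>S. open (V x) \<and> x \<in> V x \<and> (\<forall>y\<in>S \<inter> V x. w (b x) < w y)"
      by metis
    obtain T where T: "T \<subseteq> S" "finite T" "S \<subseteq> (\<Union>x\<in>T. V x)"
      using compactE_image[OF \<open>compact S\<close>, of S V] V by blast
    have "T \<noteq> {}" using T \<open>S \<noteq> {}\<close> by auto
    then obtain x where x: "x \<in> T" "\<And>z. z \<in> T \<Longrightarrow> w (b x) \<le> w (b z)"
      using arg_min_if_finite[OF T(2), of "\<lambda>x. w (b x)"] by (meson not_le)
    then have "b x \<in> S" using b(1) T(1) by blast
    then obtain z where z: "z \<in> T" "b x \<in> V z" using T(3) by blast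
    have "w (b z) < w (b x)"
      using V z T(1) \<open>b x \<in> S\<close> by blast
    with x(2)[OF z(1)] show False by simp
  qed
  then show thesis using that by blast
qed

section \<open>The interior ball\<close>

text \<open>The mean value theorem on the segment from \<open>x0\<close> to \<open>x\<close> compares \<open>f x - f x0\<close> with the gradient at an
intermediate point, and a gradient differentiable at \<open>x0\<close> deviates from its value there by \<open>O(|x - x0|)\<close>.\<close>

lemma C2_quadratic_lower_bound:
  fixes f :: "real^'n \<Rightarrow> real"
  assumes "open U" "x0 \<in> U" "C2_on U f"
  obtains C r where "C > 0" "r > 0" "ball x0 r \<subseteq> U"
    "\<And>x. x \<in> ball x0 r \<Longrightarrow> f x \<ge> f x0 + gradient f x0 \<bullet> (x - x0) - C * (norm (x - x0))\<^sup>2"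
proof -
  let ?A = "hessian f x0"
  obtain r1 where r1: "r1 > 0" "ball x0 r1 \<subseteq> U"
    using assms(1,2) open_contains_ball by blast
  have "(gradient f has_derivative (\<lambda>d. ?A *v d)) (at x0)"
    using assms by (intro hessian_has_derivative) (auto simp: C2_on_def)
  then obtain r2 where r2: "r2 > 0" and
    lin: "\<And>z. norm (z - x0) < r2 \<Longrightarrow>
            norm (gradient f z - gradient f x0 - ?A *v (z - x0)) \<le> 1 * norm (z - x0)"
    unfolding has_derivative_at_alt using zero_less_one by blast
  obtain K where K: "K > 0" "\<And>z. norm (?A *v z) \<le> K * norm z"
    using linear_bounded_pos[OF matrix_vector_mul_linear] by blast
  define r where "r = min r1 r2"
  have rU: "ball x0 r \<subseteq> U" using r1 by (auto simp: r_def)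
  have "f x \<ge> f x0 + gradient f x0 \<bullet> (x - x0) - (K + 1) * (norm (x - x0))\<^sup>2"
    if x: "x \<in> ball x0 r" for x
  proof -
    define d where "d = x - x0"
    have d: "norm d < r" using x by (simp add: d_def dist_norm norm_minus_commute)
    have seg: "norm (t *\<^sub>R d) \<le> norm d" if "0 \<le> t" "t \<le> 1" for t
      using that by (simp add: mult_left_le_one_le)
    have "((\<lambda>t. f (x0 + t *\<^sub>R d)) has_real_derivative gradient f (x0 + t *\<^sub>R d) \<bullet> d) (at t)"
      if "0 \<le> t" "t \<le> 1" for t
    proof (rule has_derivative_along_line)
      have "x0 + t *\<^sub>R d \<in> ball x0 r"
        using seg[OF that] d by (simp add: dist_norm)
      then show "f differentiable at (x0 + t *\<^sub>R d)"
        using rU assms(3) by (auto simp: C2_on_def)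
    qed
    then obtain t where t: "0 < t" "t < 1" and
      eq: "f (x0 + 1 *\<^sub>R d) - f (x0 + 0 *\<^sub>R d) = (1 - 0) * (gradient f (x0 + t *\<^sub>R d) \<bullet> d)"
      using MVT2[of 0 1 "\<lambda>t. f (x0 + t *\<^sub>R d)" "\<lambda>t. gradient f (x0 + t *\<^sub>R d) \<bullet> d"] by auto
    define D where "D = gradient f (x0 + t *\<^sub>R d) - gradient f x0"
    have td: "norm (t *\<^sub>R d) \<le> norm d" using seg t by simp
    have "norm (D - ?A *v (t *\<^sub>R d)) \<le> norm (t *\<^sub>R d)"
      using lin[of "x0 + t *\<^sub>R d"] td d by (simp add: D_def r_def)
    then have "norm D \<le> norm (t *\<^sub>R d) + K * norm (t *\<^sub>R d)"
      using norm_triangle_sub[of D "?A *v (t *\<^sub>R d)"] K(2)[of "t *\<^sub>R d"] by linarith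
    also have "\<dots> \<le> (K + 1) * norm d"
      using mult_left_mono[OF td, of "K + 1"] K(1) by (simp add: algebra_simps)
    finally have "\<bar>D \<bullet> d\<bar> \<le> (K + 1) * norm d * norm d"
      using Cauchy_Schwarz_ineq2[of D d] by (meson mult_right_mono norm_ge_zero order_trans)
    then have "D \<bullet> d \<ge> - ((K + 1) * (norm d)\<^sup>2)"
      by (simp add: power2_eq_square abs_le_iff mult.assoc)
    then show ?thesis
      using eq by (simp add: D_def d_def inner_diff_left)
  qed
  then show thesis
    using that[of "K + 1" r] rU r1 r2 K(1) by (simp add: r_def)
qed

text \<open>A point \<open>x0 + d\<close> of the ball satisfies \<open>|d|\<^sup>2 \<le> 2 R (\<nu> \<bullet> d)\<close>. So the linear part \<open>g (\<nu> \<bullet> d)\<close> of the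
defining function dominates its quadratic error \<open>C |d|\<^sup>2\<close> as soon as \<open>2 R C < g\<close>.\<close>

lemma interior_ball:
  assumes "unit_interior_normal \<Omega> x0 \<nu>" and "x0 \<in> frontier \<Omega>"
  obtains R where "R > 0" "cball (x0 + R *\<^sub>R \<nu>) R - {x0} \<subseteq> \<Omega>" "norm \<nu> = 1"
proof -
  obtain U \<rho> where def: "C2_defining_function \<Omega> x0 U \<rho>"
    and \<nu>: "\<nu> = gradient \<rho> x0 /\<^sub>R norm (gradient \<rho> x0)"
    using assms(1) unfolding unit_interior_normal_def by blast
  define g where "g = norm (gradient \<rho> x0)"
  have U: "open U" "x0 \<in> U" "C2_on U \<rho>" and pos: "\<Omega> \<inter> U = {x\<in>U. 0 < \<rho> x}"
    and zero: "\<rho> x0 = 0" and g: "g > 0"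
    using def assms(2) unfolding C2_defining_function_def g_def by auto
  have g\<nu>: "gradient \<rho> x0 = g *\<^sub>R \<nu>" and n\<nu>: "norm \<nu> = 1"
    using g by (auto simp: \<nu> g_def)
  obtain C r where C: "C > 0" "r > 0" "ball x0 r \<subseteq> U" and
    lower: "\<And>x. x \<in> ball x0 r \<Longrightarrow>
              \<rho> x \<ge> \<rho> x0 + gradient \<rho> x0 \<bullet> (x - x0) - C * (norm (x - x0))\<^sup>2"
    using C2_quadratic_lower_bound[OF U] by metis
  \<comment> \<open>\<open>r / 4\<close> keeps the ball, of diameter \<open>2 R\<close>, where the expansion holds;
    \<open>g / (4 C)\<close> makes \<open>2 R C < g\<close>.\<close>
  define R where "R = min (r / 4) (g / (4 * C))"
  have R: "R > 0" using C g by (simp add: R_def)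
  have RC: "2 * R * C < g"
  proof -
    have "R \<le> g / (4 * C)" by (simp add: R_def)
    then have "4 * C * R \<le> g" using C by (simp add: field_simps)
    then show ?thesis using g R C by (simp add: algebra_simps)
  qed
  have "cball (x0 + R *\<^sub>R \<nu>) R - {x0} \<subseteq> \<Omega>"
  proof
    fix x assume "x \<in> cball (x0 + R *\<^sub>R \<nu>) R - {x0}"
    define d where "d = x - x0"
    have d: "norm (d - R *\<^sub>R \<nu>) \<le> R" "d \<noteq> 0"
      using \<open>x \<in> _\<close> by (auto simp: d_def dist_norm norm_minus_commute algebra_simps)
    have "(norm (d - R *\<^sub>R \<nu>))\<^sup>2 \<le> R\<^sup>2"
      using d by (intro power_mono) auto
    moreover have "(norm (d - R *\<^sub>R \<nu>))\<^sup>2 = (norm d)\<^sup>2 - 2 * R * (\<nu> \<bullet> d) + R\<^sup>2"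
      unfolding power2_norm_eq_inner using n\<nu>
      by (simp add: inner_diff_left inner_diff_right inner_commute[of d \<nu>] norm_eq_1
          power2_eq_square algebra_simps)
    ultimately have nd: "(norm d)\<^sup>2 \<le> 2 * R * (\<nu> \<bullet> d)" by simp
    have "norm d \<le> norm (d - R *\<^sub>R \<nu>) + norm (R *\<^sub>R \<nu>)"
      by (metis diff_add_cancel norm_triangle_ineq)
    then have "norm d \<le> 2 * R" using d n\<nu> R by simp
    then have "norm d < r" using C(2) by (simp add: R_def min_def split: if_splits)
    then have xr: "x \<in> ball x0 r" by (simp add: d_def dist_norm norm_minus_commute)
    have "C * (norm d)\<^sup>2 \<le> C * (2 * R * (\<nu> \<bullet> d))"
      using nd C by (intro mult_left_mono) auto
    also have "\<dots> = (2 * R * C) * (\<nu> \<bullet> d)" by simp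
    also have "\<dots> < g * (\<nu> \<bullet> d)"
    proof (rule mult_strict_right_mono[OF RC])
      have "0 < (norm d)\<^sup>2" using d by simp
      then have "0 < R * (\<nu> \<bullet> d)" using nd by linarith
      then show "0 < \<nu> \<bullet> d" using R by (simp add: zero_less_mult_iff)
    qed
    also have "\<dots> = gradient \<rho> x0 \<bullet> (x - x0)" by (simp add: g\<nu> d_def)
    finally have "0 < \<rho> x"
      using lower[OF xr] zero by (simp add: d_def)
    then show "x \<in> \<Omega>" using xr C(3) pos by blast
  qed
  with R n\<nu> show thesis using that by blast
qed

section \<open>The barrier\<close>

definition outer_square :: "real^'n \<Rightarrow> real^'n^'n" where
  "outer_square a = (\<chi> i j. a $ i * a $ j)"

lemma outer_square_mult_vec: "outer_square a *v d = (a \<bullet> d) *\<^sub>R a"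
  by (simp add: outer_square_def vec_eq_iff matrix_vector_mult_def inner_vec_def
      sum_distrib_left sum_distrib_right mult_ac)

lemma inner_outer_square: "A \<bullet> outer_square a = a \<bullet> (A *v a)"
  by (simp add: outer_square_def inner_vec_def matrix_vector_mult_def sum_distrib_left mult_ac)

lemma norm_outer_square: "norm (outer_square a) = (norm a)\<^sup>2"
proof -
  have "(norm (outer_square a))\<^sup>2 = ((norm a)\<^sup>2)\<^sup>2"
    unfolding power2_norm_eq_inner[of "outer_square a"] inner_outer_square outer_square_mult_vec
    by (simp only: power2_norm_eq_inner inner_scaleR_right power2_eq_square[of "a \<bullet> a"])
  then show ?thesis by (rule power2_eq_imp_eq) simp_all
qed

lemma continuous_on_outer_square [continuous_intros]:
  "continuous_on S f \<Longrightarrow> continuous_on S (\<lambda>x. outer_square (f x))"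
  unfolding outer_square_def by (intro continuous_intros)

lemma barrier_matrix_sym: "c *\<^sub>R (a *\<^sub>R outer_square d - b *\<^sub>R mat 1) \<in> sym_matrices"
  by (auto simp: sym_matrices_def transpose_def outer_square_def mat_def vec_eq_iff mult.commute)

definition gaussian :: "real \<Rightarrow> real^'n \<Rightarrow> real^'n \<Rightarrow> real" where
  "gaussian \<alpha> y x = exp (- \<alpha> * (norm (x - y))\<^sup>2)"

lemma gaussian_pos: "0 < gaussian \<alpha> y x"
  by (simp add: gaussian_def)

lemma gaussian_le_1: "0 \<le> \<alpha> \<Longrightarrow> gaussian \<alpha> y x \<le> 1"
  by (simp add: gaussian_def)

lemma continuous_on_gaussian [continuous_intros]:
  "continuous_on S (gaussian \<alpha> y)"
  unfolding gaussian_def by (intro continuous_intros)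

lemma gaussian_has_derivative:
  "(gaussian \<alpha> y has_derivative (\<lambda>d. ((- 2 * \<alpha> * gaussian \<alpha> y x) *\<^sub>R (x - y)) \<bullet> d)) (at x)"
  unfolding gaussian_def power2_norm_eq_inner
  by (rule has_derivative_eq_rhs, (rule derivative_intros)+) (auto simp: inner_commute fun_eq_iff algebra_simps)

text \<open>The additive constant and the factor are carried along because the test function of the final proof differs
from \<open>v\<close> by a function of exactly this form.\<close>

lemma
  fixes y :: "real^'n"
  shows gradient_gaussian:
      "gradient (\<lambda>x. c + \<epsilon> * gaussian \<alpha> y x) x = (- 2 * \<alpha> * \<epsilon> * gaussian \<alpha> y x) *\<^sub>R (x - y)"
    and hessian_gaussian:
      "hessian (\<lambda>x. c + \<epsilon> * gaussian \<alpha> y x) x =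
         (\<epsilon> * gaussian \<alpha> y x) *\<^sub>R ((4 * \<alpha>\<^sup>2) *\<^sub>R outer_square (x - y) - (2 * \<alpha>) *\<^sub>R mat 1)"
    and C2_on_gaussian: "C2_on U (\<lambda>x. c + \<epsilon> * gaussian \<alpha> y x)"
proof -
  let ?f = "\<lambda>x. c + \<epsilon> * gaussian \<alpha> y x"
  have deriv1: "(?f has_derivative (\<lambda>d. ((- 2 * \<alpha> * \<epsilon> * gaussian \<alpha> y x) *\<^sub>R (x - y)) \<bullet> d)) (at x)" for x
    by (rule has_derivative_eq_rhs, (rule derivative_intros gaussian_has_derivative)+)
       (auto simp: fun_eq_iff)
  have grad: "gradient ?f x = (- 2 * \<alpha> * \<epsilon> * gaussian \<alpha> y x) *\<^sub>R (x - y)" for x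
    by (rule gradient_eqI) (rule deriv1)
  let ?H = "\<lambda>x. (\<epsilon> * gaussian \<alpha> y x) *\<^sub>R ((4 * \<alpha>\<^sup>2) *\<^sub>R outer_square (x - y) - (2 * \<alpha>) *\<^sub>R mat 1)"
  have deriv2: "(gradient ?f has_derivative (\<lambda>d. ?H x *v d)) (at x)" for x
  proof -
    have "((\<lambda>x. (- 2 * \<alpha> * \<epsilon> * gaussian \<alpha> y x) *\<^sub>R (x - y)) has_derivative
           (\<lambda>d. (- 2 * \<alpha> * \<epsilon> * gaussian \<alpha> y x) *\<^sub>R d
              + (- 2 * \<alpha> * \<epsilon> * (((- 2 * \<alpha> * gaussian \<alpha> y x) *\<^sub>R (x - y)) \<bullet> d)) *\<^sub>R (x - y))) (at x)"
      by (rule has_derivative_eq_rhs, (rule derivative_intros gaussian_has_derivative)+)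
         (auto simp: fun_eq_iff)
    moreover have "(- 2 * \<alpha> * \<epsilon> * g) *\<^sub>R d + (- 2 * \<alpha> * \<epsilon> * (((- 2 * \<alpha> * g) *\<^sub>R z) \<bullet> d)) *\<^sub>R z
        = ((\<epsilon> * g) *\<^sub>R ((4 * \<alpha>\<^sup>2) *\<^sub>R outer_square z - (2 * \<alpha>) *\<^sub>R mat 1)) *v d" for g d and z :: "real^'n"
      by (simp add: matrix_vector_mult_diff_rdistrib outer_square_mult_vec
          scaleR_matrix_vector_assoc[symmetric] power2_eq_square scaleR_diff_right mult_ac)
    ultimately show ?thesis
      unfolding grad[abs_def] by simp
  qed
  have hess: "hessian ?f x = ?H x" for x
    by (rule hessian_eqI) (rule deriv2)
  show "gradient ?f x = (- 2 * \<alpha> * \<epsilon> * gaussian \<alpha> y x) *\<^sub>R (x - y)"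
    by (rule grad)
  show "hessian ?f x = ?H x"
    by (rule hess)
  have "continuous_on U (hessian ?f)"
    unfolding hess[abs_def] by (intro continuous_intros)
  then show "C2_on U ?f"
    using deriv1 deriv2 unfolding C2_on_def by (auto intro: differentiableI)
qed

text \<open>The arguments range over a compact set, and the quadratic form need only be bounded below on unit vectors.
The derivatives with respect to \<open>M\<close> enter the barrier estimate through the trace \<open>A \<bullet> mat 1\<close> and the form
\<open>\<xi> \<bullet> A \<xi>\<close>.\<close>

lemma uniform_bounds_of_coefficients:
  fixes F :: "'n::finite nonlinearity"
  assumes C1: "C1_in_spM X F" and elliptic: "elliptic_on X F" and K: "compact K" "K \<subseteq> X"
  obtains lo C where "lo > 0" "C > 0"
    "\<And>x s p M. x \<in> K \<Longrightarrow> \<bar>s\<bar> \<le> B \<Longrightarrow> norm p \<le> B \<Longrightarrow> norm M \<le> B \<Longrightarrow> M \<in> sym_matrices \<Longrightarrow>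
       \<bar>partial_s F x s p M\<bar> \<le> C \<and> norm (partial_p F x s p M) \<le> C \<and>
       \<bar>partial_M F x s p M \<bullet> mat 1\<bar> \<le> C \<and> (\<forall>\<xi>. lo * (norm \<xi>)\<^sup>2 \<le> \<xi> \<bullet> (partial_M F x s p M *v \<xi>))"
proof -
  define Q where "Q = K \<times> cball (0::real) B \<times> cball (0::real^'n) B \<times> (cball (0::real^'n^'n) B \<inter> sym_matrices)"
  let ?s = "\<lambda>(x, s, p, M). partial_s F x s p M"
  let ?p = "\<lambda>(x, s, p, M). partial_p F x s p M"
  let ?M = "\<lambda>(x, s, p, M). partial_M F x s p M"
  have Q: "compact Q"
    unfolding Q_def
    by (intro compact_Times K compact_cball compact_Int_closed closed_subspace subspace_sym_matrices)
  have "Q \<subseteq> X \<times> UNIV \<times> UNIV \<times> sym_matrices"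
    using K by (auto simp: Q_def)
  then have cont: "continuous_on Q ?s" "continuous_on Q ?p" "continuous_on Q ?M"
    using C1 unfolding C1_in_spM_def by (auto elim: continuous_on_subset)
  have bdd: "\<exists>c. \<forall>z\<in>Q. norm (f z) \<le> c" if "continuous_on Q f" for f :: "_ \<Rightarrow> 'b::real_normed_vector"
    using compact_imp_bounded[OF compact_continuous_image[OF that Q]] by (simp add: bounded_iff)
  have "continuous_on Q (\<lambda>z. ?M z \<bullet> mat 1)"
    by (rule continuous_on_inner[OF cont(3) continuous_on_const])
  from bdd[OF cont(1)] bdd[OF cont(2)] bdd[OF this]
  obtain C1 C2 C3 where C: "\<And>z. z \<in> Q \<Longrightarrow> norm (?s z) \<le> C1" "\<And>z. z \<in> Q \<Longrightarrow> norm (?p z) \<le> C2"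
    "\<And>z. z \<in> Q \<Longrightarrow> norm (?M z \<bullet> mat 1) \<le> C3"
    by metis
  define C where "C = \<bar>C1\<bar> + \<bar>C2\<bar> + \<bar>C3\<bar> + 1"
  have pos: "0 < \<xi> \<bullet> (?M z *v \<xi>)" if "z \<in> Q" "\<xi> \<noteq> 0" for z \<xi>
    using that elliptic K by (auto simp: Q_def elliptic_on_def pos_def_def)
  \<comment> \<open>Written as \<open>A \<bullet> outer_square \<xi>\<close>, the quadratic form is visibly continuous in \<open>A\<close> and \<open>\<xi>\<close> jointly.\<close>
  have "\<exists>lo>0. \<forall>z\<in>Q. \<forall>\<xi>\<in>sphere 0 1. lo \<le> \<xi> \<bullet> (?M z *v \<xi>)"
  proof (cases "Q \<times> sphere (0::real^'n) 1 = {}")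
    case True
    then show ?thesis by (intro exI[of _ 1]) auto
  next
    case False
    have "continuous_on (Q \<times> sphere 0 1) (\<lambda>z. ?M (fst z) \<bullet> outer_square (snd z))"
      by (intro continuous_intros continuous_on_compose2[OF cont(3)]) auto
    from continuous_attains_inf[OF compact_Times[OF Q compact_sphere] False this]
    obtain z\<^sub>0 where z0: "z\<^sub>0 \<in> Q \<times> sphere 0 1" and
      min: "\<And>z. z \<in> Q \<times> sphere 0 1 \<Longrightarrow>
              ?M (fst z\<^sub>0) \<bullet> outer_square (snd z\<^sub>0) \<le> ?M (fst z) \<bullet> outer_square (snd z)"
      by blast
    show ?thesis
    proof (intro exI conjI ballI)
      show "0 < ?M (fst z\<^sub>0) \<bullet> outer_square (snd z\<^sub>0)"
        using pos[of "fst z\<^sub>0" "snd z\<^sub>0"] z0 unfolding inner_outer_square by force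
      fix z \<xi> assume "z \<in> Q" "\<xi> \<in> sphere (0::real^'n) 1"
      then show "?M (fst z\<^sub>0) \<bullet> outer_square (snd z\<^sub>0) \<le> \<xi> \<bullet> (?M z *v \<xi>)"
        using min[of "(z, \<xi>)"] by (simp add: inner_outer_square)
    qed
  qed
  then obtain lo where lo: "lo > 0" "\<And>z \<xi>. z \<in> Q \<Longrightarrow> \<xi> \<in> sphere 0 1 \<Longrightarrow> lo \<le> \<xi> \<bullet> (?M z *v \<xi>)"
    by blast
  have lower: "lo * (norm \<xi>)\<^sup>2 \<le> \<xi> \<bullet> (?M z *v \<xi>)" if z: "z \<in> Q" for z \<xi>
  proof (cases "\<xi> = 0")
    case False
    define \<eta> where "\<eta> = \<xi> /\<^sub>R norm \<xi>"
    have \<eta>: "\<eta> \<in> sphere 0 1" and \<xi>: "\<xi> = norm \<xi> *\<^sub>R \<eta>"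
      using False by (auto simp: \<eta>_def)
    have "\<xi> \<bullet> (?M z *v \<xi>) = (norm \<xi>)\<^sup>2 * (\<eta> \<bullet> (?M z *v \<eta>))"
      by (subst (1 2) \<xi>) (simp add: matrix_vector_mult_scaleR power2_eq_square)
    then show ?thesis
      using mult_left_mono[OF lo(2)[OF z \<eta>], of "(norm \<xi>)\<^sup>2"] by (simp add: mult.commute)
  qed simp
  show thesis
  proof (rule that[of lo C])
    show "C > 0" by (simp add: C_def)
    fix x p :: "real^'n" and s :: real and M :: "real^'n^'n"
    assume "x \<in> K" "\<bar>s\<bar> \<le> B" "norm p \<le> B" "norm M \<le> B" "M \<in> sym_matrices"
    then have "(x, s, p, M) \<in> Q" by (simp add: Q_def)
    from C[OF this] lower[OF this]
    show "\<bar>partial_s F x s p M\<bar> \<le> C \<and> norm (partial_p F x s p M) \<le> C \<and>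
       \<bar>partial_M F x s p M \<bullet> mat 1\<bar> \<le> C \<and> (\<forall>\<xi>. lo * (norm \<xi>)\<^sup>2 \<le> \<xi> \<bullet> (partial_M F x s p M *v \<xi>))"
      by (auto simp: C_def)
  qed (rule lo)
qed

text \<open>With \<open>z = x - y\<close> and \<open>e = \<epsilon> gaussian\<close>, the increments are \<open>0 \<le> \<sigma> \<le> e\<close>, \<open>q = - 2 \<alpha> e z\<close> and
\<open>N = e (4 \<alpha>\<^sup>2 z z\<^sup>T - 2 \<alpha> I)\<close>. The three terms of the mean value formula are therefore at least \<open>- C e\<close>,
\<open>- 2 \<alpha> C R e\<close> and \<open>e (4 \<alpha>\<^sup>2 lo r\<^sup>2 - 2 \<alpha> C)\<close>, where \<open>lo\<close> is the ellipticity constant, \<open>C\<close> bounds the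
coefficients and \<open>R\<close> bounds \<open>|z|\<close>. Their sum is positive for large \<open>\<alpha>\<close>. The constants \<open>lo\<close> and \<open>C\<close> belong
to arguments bounded by \<open>B + 1\<close>; they do not depend on \<open>\<alpha>\<close> because \<open>\<epsilon>\<^sub>0\<close>, chosen after \<open>\<alpha>\<close>, keeps all
increments of size at most \<open>1\<close>.\<close>

lemma gaussian_perturbation_increases:
  fixes F :: "'n::finite nonlinearity" and B :: real
  assumes C1: "C1_in_spM X F" and elliptic: "elliptic_on X F" and K: "compact K" "K \<subseteq> X"
    and "0 < r" and away: "\<And>x. x \<in> K \<Longrightarrow> r \<le> norm (x - y)"
  obtains \<alpha> \<epsilon>\<^sub>0 where "\<alpha> > 0" "\<epsilon>\<^sub>0 > 0"
    "\<And>x s p M \<epsilon> \<sigma> c. x \<in> K \<Longrightarrow> \<bar>s\<bar> \<le> B \<Longrightarrow> norm p \<le> B \<Longrightarrow> norm M \<le> B \<Longrightarrow> M \<in> sym_matrices \<Longrightarrow>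
       0 < \<epsilon> \<Longrightarrow> \<epsilon> \<le> \<epsilon>\<^sub>0 \<Longrightarrow> 0 \<le> \<sigma> \<Longrightarrow> \<sigma> \<le> \<epsilon> * gaussian \<alpha> y x \<Longrightarrow>
       F x s p M < F x (s + \<sigma>) (p + gradient (\<lambda>x. c + \<epsilon> * gaussian \<alpha> y x) x)
         (M + hessian (\<lambda>x. c + \<epsilon> * gaussian \<alpha> y x) x)"
proof -
  obtain lo C where lo: "lo > 0" and C: "C > 0" and
    bounds: "\<And>x s p M. x \<in> K \<Longrightarrow> \<bar>s\<bar> \<le> B + 1 \<Longrightarrow> norm p \<le> B + 1 \<Longrightarrow> norm M \<le> B + 1 \<Longrightarrow> M \<in> sym_matrices \<Longrightarrow>
       \<bar>partial_s F x s p M\<bar> \<le> C \<and> norm (partial_p F x s p M) \<le> C \<and>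
       \<bar>partial_M F x s p M \<bullet> mat 1\<bar> \<le> C \<and> (\<forall>\<xi>. lo * (norm \<xi>)\<^sup>2 \<le> \<xi> \<bullet> (partial_M F x s p M *v \<xi>))"
    by (rule uniform_bounds_of_coefficients[OF C1 elliptic K, of "B + 1"]) blast
  obtain R0 where "\<And>x. x \<in> K \<Longrightarrow> norm x \<le> R0"
    using compact_imp_bounded[OF K(1)] unfolding bounded_iff by blast
  define R where "R = \<bar>R0\<bar> + norm y"
  have R: "norm (x - y) \<le> R" if "x \<in> K" for x
    using \<open>x \<in> K \<Longrightarrow> norm x \<le> R0\<close>[OF that] norm_triangle_ineq4[of x y] by (simp add: R_def)
  have R0: "R \<ge> 0" by (simp add: R_def)
  \<comment> \<open>As \<open>\<alpha> \<ge> 1\<close>, the bad terms add up to at most \<open>e \<alpha> C (2 R + 3)\<close>, against the good term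
    \<open>4 e \<alpha>\<^sup>2 lo r\<^sup>2\<close>.\<close>
  define \<alpha> where "\<alpha> = 1 + C * (2 * R + 3) / (4 * lo * r\<^sup>2)"
  have \<alpha>: "\<alpha> \<ge> 1" using C R0 lo by (simp add: \<alpha>_def)
  have \<alpha>_large: "C * (2 * R + 3) < 4 * \<alpha> * lo * r\<^sup>2"
  proof -
    have "4 * \<alpha> * lo * r\<^sup>2 = 4 * lo * r\<^sup>2 + C * (2 * R + 3)"
      using lo \<open>0 < r\<close> by (simp add: \<alpha>_def field_simps)
    then show ?thesis using lo \<open>0 < r\<close> by simp
  qed
  \<comment> \<open>Every increment has size at most \<open>e Z \<le> \<epsilon> Z\<close>, whence the choice \<open>\<epsilon>\<^sub>0 = 1 / Z\<close>.\<close>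
  define Z where "Z = 1 + 2 * \<alpha> * R + 4 * \<alpha>\<^sup>2 * R\<^sup>2 + 2 * \<alpha> * norm (mat 1 :: real^'n^'n)"
  have Z: "Z \<ge> 1" using \<alpha> R0 by (simp add: Z_def)
  have Z': "2 * \<alpha> * R \<le> Z" "4 * \<alpha>\<^sup>2 * R\<^sup>2 + 2 * \<alpha> * norm (mat 1 :: real^'n^'n) \<le> Z"
    using \<alpha> R0 by (simp_all add: Z_def)
  show thesis
  proof (rule that[of \<alpha> "1 / Z"])
    show "\<alpha> > 0" "1 / Z > 0" using \<alpha> Z by auto
    fix x p :: "real^'n" and s \<epsilon> \<sigma> c :: real and M :: "real^'n^'n"
    assume x: "x \<in> K" and sB: "\<bar>s\<bar> \<le> B" and pB: "norm p \<le> B" and MB: "norm M \<le> B"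
      and M: "M \<in> sym_matrices" and \<epsilon>: "0 < \<epsilon>" "\<epsilon> \<le> 1 / Z"
      and \<sigma>: "0 \<le> \<sigma>" "\<sigma> \<le> \<epsilon> * gaussian \<alpha> y x"
    define z where "z = x - y"
    define e where "e = \<epsilon> * gaussian \<alpha> y x"
    define q where "q = (- 2 * \<alpha> * \<epsilon> * gaussian \<alpha> y x) *\<^sub>R z"
    define N :: "real^'n^'n" where "N = e *\<^sub>R ((4 * \<alpha>\<^sup>2) *\<^sub>R outer_square z - (2 * \<alpha>) *\<^sub>R mat 1)"
    have z: "norm z \<le> R" "r \<le> norm z" using R away x by (auto simp: z_def)
    have e: "e > 0" using \<epsilon> gaussian_pos[of \<alpha> y x] by (simp add: e_def)
    have "e \<le> \<epsilon> * 1"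
      unfolding e_def using \<epsilon> \<alpha> by (intro mult_left_mono gaussian_le_1) auto
    then have "e \<le> 1 / Z" using \<epsilon> by simp
    then have eZ: "e * Z \<le> 1" using Z by (simp add: field_simps)
    have small: "e * t \<le> 1" if "t \<le> Z" for t
      using mult_left_mono[OF that, of e] e eZ by linarith
    have q_eq: "q = - ((e * (2 * \<alpha>)) *\<^sub>R z)" by (simp add: q_def e_def mult_ac)
    have "norm q = e * (2 * \<alpha> * norm z)" using e \<alpha> by (simp add: q_eq)
    also have "\<dots> \<le> 1"
    proof (rule small)
      have "2 * \<alpha> * norm z \<le> 2 * \<alpha> * R"
        using z(1) \<alpha> by (intro mult_left_mono) auto
      then show "2 * \<alpha> * norm z \<le> Z"
        using Z'(1) by linarith
    qed
    finally have q1: "norm q \<le> 1" .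
    have "norm N = e * norm ((4 * \<alpha>\<^sup>2) *\<^sub>R outer_square z - (2 * \<alpha>) *\<^sub>R (mat 1 :: real^'n^'n))"
      using e by (simp add: N_def)
    also have "\<dots> \<le> 1"
    proof (rule small)
      have "norm ((4 * \<alpha>\<^sup>2) *\<^sub>R outer_square z - (2 * \<alpha>) *\<^sub>R (mat 1 :: real^'n^'n))
          \<le> norm ((4 * \<alpha>\<^sup>2) *\<^sub>R outer_square z) + norm ((2 * \<alpha>) *\<^sub>R (mat 1 :: real^'n^'n))"
        by (rule norm_triangle_ineq4)
      also have "\<dots> = 4 * \<alpha>\<^sup>2 * (norm z)\<^sup>2 + 2 * \<alpha> * norm (mat 1 :: real^'n^'n)"
        using \<alpha> by (simp add: norm_outer_square)
      also have "\<dots> \<le> 4 * \<alpha>\<^sup>2 * R\<^sup>2 + 2 * \<alpha> * norm (mat 1 :: real^'n^'n)"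
        using z(1) by (intro add_right_mono mult_left_mono power_mono) auto
      finally show "norm ((4 * \<alpha>\<^sup>2) *\<^sub>R outer_square z - (2 * \<alpha>) *\<^sub>R (mat 1 :: real^'n^'n)) \<le> Z"
        using Z' by linarith
    qed
    finally have N1: "norm N \<le> 1" .
    have \<sigma>e: "\<sigma> \<le> e" using \<sigma> by (simp add: e_def)
    have \<sigma>1: "\<bar>\<sigma>\<bar> \<le> 1" using \<sigma>e \<sigma>(1) small[OF Z] by simp
    have N: "N \<in> sym_matrices" unfolding N_def by (rule barrier_matrix_sym)
    obtain \<theta> where \<theta>: "0 < \<theta>" "\<theta> < 1" and mv:
      "F x (s + \<sigma>) (p + q) (M + N) - F x s p M =
         partial_s F x (s + \<theta> * \<sigma>) (p + \<theta> *\<^sub>R q) (M + \<theta> *\<^sub>R N) * \<sigma>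
         + partial_p F x (s + \<theta> * \<sigma>) (p + \<theta> *\<^sub>R q) (M + \<theta> *\<^sub>R N) \<bullet> q
         + partial_M F x (s + \<theta> * \<sigma>) (p + \<theta> *\<^sub>R q) (M + \<theta> *\<^sub>R N) \<bullet> N"
      using nonlinearity_mean_value[OF C1 _ M N] x K(2) by blast
    define a where "a = partial_s F x (s + \<theta> * \<sigma>) (p + \<theta> *\<^sub>R q) (M + \<theta> *\<^sub>R N)"
    define b where "b = partial_p F x (s + \<theta> * \<sigma>) (p + \<theta> *\<^sub>R q) (M + \<theta> *\<^sub>R N)"
    define A where "A = partial_M F x (s + \<theta> * \<sigma>) (p + \<theta> *\<^sub>R q) (M + \<theta> *\<^sub>R N)"
    have abs1: "\<theta> * t \<le> 1" if "0 \<le> t" "t \<le> 1" for t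
      using that \<theta> by (meson less_imp_le mult_le_one)
    have "\<bar>s + \<theta> * \<sigma>\<bar> \<le> B + 1"
      using sB abs1[OF \<sigma>(1)] \<sigma>1 \<sigma>(1) \<theta> mult_nonneg_nonneg[of \<theta> \<sigma>] by linarith
    moreover have "norm (p + \<theta> *\<^sub>R q) \<le> B + 1"
      using pB abs1[of "norm q"] q1 \<theta> by (intro norm_triangle_le) simp
    moreover have "norm (M + \<theta> *\<^sub>R N) \<le> B + 1"
      using MB abs1[of "norm N"] N1 \<theta> by (intro norm_triangle_le) simp
    moreover have "M + \<theta> *\<^sub>R N \<in> sym_matrices"
      by (intro subspace_add[OF subspace_sym_matrices] subspace_scale[OF subspace_sym_matrices] M N)
    ultimately have aC: "\<bar>a\<bar> \<le> C" and bC: "norm b \<le> C" and AC: "\<bar>A \<bullet> mat 1\<bar> \<le> C"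
      and Alo: "lo * (norm z)\<^sup>2 \<le> z \<bullet> (A *v z)"
      using bounds[OF x] unfolding a_def b_def A_def by blast+
    have "\<bar>a * \<sigma>\<bar> \<le> C * e"
      unfolding abs_mult using aC \<sigma>e \<sigma>(1) C by (intro mult_mono) auto
    then have ta: "a * \<sigma> \<ge> e * (- C)" by (simp add: abs_le_iff mult.commute)
    have tb: "b \<bullet> q \<ge> e * (- (2 * \<alpha> * (C * R)))"
    proof -
      have "b \<bullet> z \<le> norm b * norm z" by (rule norm_cauchy_schwarz)
      also have "\<dots> \<le> C * R" using bC z C by (intro mult_mono) auto
      finally have "(e * (2 * \<alpha>)) * (b \<bullet> z) \<le> (e * (2 * \<alpha>)) * (C * R)"
        using e \<alpha> by (intro mult_left_mono) auto
      then show ?thesis by (simp add: q_eq)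
    qed
    have tA: "A \<bullet> N \<ge> e * (4 * \<alpha>\<^sup>2 * (lo * r\<^sup>2) - 2 * \<alpha> * C)"
    proof -
      have "lo * r\<^sup>2 \<le> z \<bullet> (A *v z)"
        using Alo z \<open>0 < r\<close> lo by (meson less_imp_le mult_left_mono order_trans power_mono)
      then have "4 * \<alpha>\<^sup>2 * (lo * r\<^sup>2) - 2 * \<alpha> * C \<le> 4 * \<alpha>\<^sup>2 * (z \<bullet> (A *v z)) - 2 * \<alpha> * (A \<bullet> mat 1)"
        using AC \<alpha> by (intro diff_mono mult_left_mono) auto
      then show ?thesis
        using e by (simp add: N_def inner_diff_right inner_outer_square)
    qed
    have "0 < e * (\<alpha> * (4 * \<alpha> * lo * r\<^sup>2 - C * (2 * R + 3)))"
      using e \<alpha> \<alpha>_large by simp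
    also have "\<dots> \<le> e * ((- C) + (- (2 * \<alpha> * (C * R))) + (4 * \<alpha>\<^sup>2 * (lo * r\<^sup>2) - 2 * \<alpha> * C))"
    proof (rule mult_left_mono)
      have "C \<le> \<alpha> * C" using \<alpha> C by simp
      then show "\<alpha> * (4 * \<alpha> * lo * r\<^sup>2 - C * (2 * R + 3)) \<le>
          (- C) + (- (2 * \<alpha> * (C * R))) + (4 * \<alpha>\<^sup>2 * (lo * r\<^sup>2) - 2 * \<alpha> * C)"
        by (simp add: algebra_simps power2_eq_square)
    qed (use e in simp)
    also have "\<dots> \<le> a * \<sigma> + b \<bullet> q + A \<bullet> N"
      unfolding distrib_left using ta tb tA by linarith
    also have "\<dots> = F x (s + \<sigma>) (p + q) (M + N) - F x s p M"
      unfolding a_def b_def A_def by (rule mv[symmetric])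
    finally show "F x s p M < F x (s + \<sigma>) (p + gradient (\<lambda>x. c + \<epsilon> * gaussian \<alpha> y x) x)
         (M + hessian (\<lambda>x. c + \<epsilon> * gaussian \<alpha> y x) x)"
      unfolding gradient_gaussian hessian_gaussian q_def z_def N_def e_def by simp
  qed
qed

section \<open>The Hopf lemma\<close>

lemma viscosity_leD:
  assumes "viscosity_le \<Omega> F u v" "open \<Omega>" "x0 \<in> \<Omega>" "C2_on \<Omega> \<phi>"
    and "\<forall>\<^sub>F x in nhds x0. \<phi> x \<le> u x" "\<phi> x0 = u x0"
  shows "F x0 (\<phi> x0) (gradient \<phi> x0) (hessian \<phi> x0) \<le> F x0 (v x0) (gradient v x0) (hessian v x0)"
  using assms unfolding viscosity_le_def by blast

theorem theorem3p2:
  fixes \<Omega> :: "(real^'n::finite) set"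
    and F :: "real^'n \<Rightarrow> real \<Rightarrow> real^'n \<Rightarrow> real^'n^'n \<Rightarrow> real"
    and u v :: "real^'n \<Rightarrow> real"
    and xhat \<nu> :: "real^'n"
  assumes "open \<Omega>" and "connected \<Omega>"
    and "continuous_on (closure \<Omega> \<times> UNIV \<times> UNIV \<times> sym_matrices) (\<lambda>(x, s, p, M). F x s p M)"
    and "C1_in_spM (closure \<Omega>) F"
    and "elliptic_on (closure \<Omega>) F"
    and "lsc_on (closure \<Omega>) u"
    and "C2_on_closure \<Omega> v"
    and "viscosity_le \<Omega> F u v"
    and "\<forall>x\<in>\<Omega>. u x > v x"
    and "xhat \<in> frontier \<Omega>" and "u xhat = v xhat"
    and "C2_boundary_near \<Omega> xhat"
    and "unit_interior_normal \<Omega> xhat \<nu>"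
  shows "Liminf (at_right 0)
           (\<lambda>s. ereal ((u (xhat + s *\<^sub>R \<nu>) - v (xhat + s *\<^sub>R \<nu>)) / s)) > 0"
proof -
  obtain R where R: "R > 0" and ball: "cball (xhat + R *\<^sub>R \<nu>) R - {xhat} \<subseteq> \<Omega>" and \<nu>: "norm \<nu> = 1"
    using interior_ball[OF assms(13,10)] .
  define y where "y = xhat + R *\<^sub>R \<nu>"
  define K where "K = cball y R \<inter> cball xhat (R / 2)"
  have K: "compact K" unfolding K_def by (intro compact_Int compact_cball)
  have K\<Omega>: "K - {xhat} \<subseteq> \<Omega>" using ball by (auto simp: K_def y_def)
  have xhat_cl: "xhat \<in> closure \<Omega>" using assms(10) by (simp add: frontier_def)
  have Kcl: "K \<subseteq> closure \<Omega>" using K\<Omega> xhat_cl closure_subset[of \<Omega>] by blast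
  have dist_xy: "dist xhat y = R" using R \<nu> by (simp add: y_def dist_norm)
  have away: "R / 2 \<le> norm (x - y)" if "x \<in> K" for x
    using that dist_xy dist_triangle[of xhat y x] by (simp add: K_def dist_norm)

  obtain G H where v: "C2_on \<Omega> v" "continuous_on (closure \<Omega>) v"
    and G: "continuous_on (closure \<Omega>) G" "\<And>x. x \<in> \<Omega> \<Longrightarrow> G x = gradient v x"
    and H: "continuous_on (closure \<Omega>) H" "\<And>x. x \<in> \<Omega> \<Longrightarrow> H x = hessian v x"
    using assms(7) unfolding C2_on_closure_def by blast
  have "bounded (v ` K)" "bounded (G ` K)" "bounded (H ` K)"
    using v(2) G(1) H(1) by (auto intro!: compact_imp_bounded compact_continuous_image K
        intro: continuous_on_subset[OF _ Kcl])
  then obtain B1 B2 B3 where B123: "\<And>x. x \<in> K \<Longrightarrow> norm (v x) \<le> B1" "\<And>x. x \<in> K \<Longrightarrow> norm (G x) \<le> B2"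
      "\<And>x. x \<in> K \<Longrightarrow> norm (H x) \<le> B3"
    unfolding bounded_iff by (metis imageI)
  define B where "B = max B1 (max B2 B3)"
  have B: "\<bar>v x\<bar> \<le> B" "norm (gradient v x) \<le> B" "norm (hessian v x) \<le> B" if "x \<in> K" "x \<in> \<Omega>" for x
    using B123[OF that(1)] G(2) H(2) that(2) by (auto simp: B_def)

  obtain \<alpha> \<epsilon>\<^sub>0 where \<alpha>: "\<alpha> > 0" and \<epsilon>0: "\<epsilon>\<^sub>0 > 0" and increase:
    "\<And>x s p M \<epsilon> \<sigma> c. x \<in> K \<Longrightarrow> \<bar>s\<bar> \<le> B \<Longrightarrow> norm p \<le> B \<Longrightarrow> norm M \<le> B \<Longrightarrow> M \<in> sym_matrices \<Longrightarrow>
       0 < \<epsilon> \<Longrightarrow> \<epsilon> \<le> \<epsilon>\<^sub>0 \<Longrightarrow> 0 \<le> \<sigma> \<Longrightarrow> \<sigma> \<le> \<epsilon> * gaussian \<alpha> y x \<Longrightarrow>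
       F x s p M < F x (s + \<sigma>) (p + gradient (\<lambda>x. c + \<epsilon> * gaussian \<alpha> y x) x)
         (M + hessian (\<lambda>x. c + \<epsilon> * gaussian \<alpha> y x) x)"
    proof (rule gaussian_perturbation_increases[OF assms(4,5) K Kcl half_gt_zero[OF R], of y B])
    show "R / 2 \<le> norm (x - y)" if "x \<in> K" for x using that by (rule away)
  qed (rule that)

  have lsc_diff: "lsc_on K (\<lambda>x. u x + - v x)"
    by (intro lsc_on_add_continuous lsc_on_subset[OF assms(6) Kcl] continuous_on_minus
        continuous_on_subset[OF v(2) Kcl])
  define S where "S = K \<inter> sphere xhat (R / 2)"
  have S\<Omega>: "S \<subseteq> \<Omega>" using K\<Omega> R by (auto simp: S_def)
  obtain m where m: "m > 0" "\<And>x. x \<in> S \<Longrightarrow> m \<le> u x - v x"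
  proof (cases "S = {}")
    case False
    have "compact S" unfolding S_def using K by (intro compact_Int) auto
    moreover have "lsc_on S (\<lambda>x. u x + - v x)"
      by (rule lsc_on_subset[OF lsc_diff]) (auto simp: S_def)
    ultimately obtain x where "x \<in> S" "\<And>z. z \<in> S \<Longrightarrow> u x + - v x \<le> u z + - v z"
      using lsc_attains_inf False by blast
    then show thesis using that[of "u x - v x"] assms(9) S\<Omega> by force
  qed (use that[of 1] in auto)

  define \<epsilon> where "\<epsilon> = min \<epsilon>\<^sub>0 m"
  have \<epsilon>: "\<epsilon> > 0" "\<epsilon> \<le> \<epsilon>\<^sub>0" "\<epsilon> \<le> m" using \<epsilon>0 m by (auto simp: \<epsilon>_def)
  define E where "E = exp (- \<alpha> * R\<^sup>2)"
  have E: "E > 0" by (simp add: E_def)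
  \<comment> \<open>\<open>E\<close> is the value of the Gaussian on the sphere of radius \<open>R\<close>, so \<open>b\<close> vanishes there.\<close>
  define b where "b = (\<lambda>x. - (\<epsilon> * E) + \<epsilon> * gaussian \<alpha> y x)"
  define w where "w = (\<lambda>x. (u x + - v x) + - b x)"
  have w_nonneg: "0 \<le> w x" if xK: "x \<in> K" for x
  proof (rule ccontr)
    assume neg: "\<not> 0 \<le> w x"
    have "lsc_on K w"
      unfolding w_def b_def
      by (intro lsc_on_add_continuous lsc_diff continuous_intros)
    then obtain z where z: "z \<in> K" and z_min: "\<And>x. x \<in> K \<Longrightarrow> w z \<le> w x"
      using lsc_attains_inf[OF K] xK by blast
    have wz: "w z < 0" using neg z_min[OF xK] by simp
    have uv: "u z - v z \<ge> 0"
      using K\<Omega> z assms(9,11) by (cases "z = xhat") (auto simp: less_imp_le)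
    have bz: "b z > 0" using wz uv by (simp add: w_def)
    have "dist y z < R"
    proof (rule ccontr)
      assume "\<not> dist y z < R"
      then have "dist y z = R" using z by (simp add: K_def)
      then have "b z = 0" by (simp add: b_def gaussian_def E_def dist_norm norm_minus_commute)
      then show False using bz by simp
    qed
    moreover have "dist xhat z < R / 2"
    proof (rule ccontr)
      assume "\<not> dist xhat z < R / 2"
      then have "z \<in> S" using z by (simp add: K_def S_def)
      then have "m \<le> u z - v z" by (rule m)
      moreover have "b z \<le> \<epsilon> * 1"
      proof -
        have "\<epsilon> * gaussian \<alpha> y z \<le> \<epsilon> * 1"
          using \<epsilon> \<alpha> by (intro mult_left_mono gaussian_le_1) auto
        moreover have "0 \<le> \<epsilon> * E" using \<epsilon> E by simp
        ultimately show ?thesis unfolding b_def by linarith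
      qed
      ultimately show False using wz \<epsilon> by (simp add: w_def)
    qed
    ultimately have z_int: "z \<in> ball y R \<inter> ball xhat (R / 2)" by simp
    have z\<Omega>: "z \<in> \<Omega>"
      using K\<Omega> z \<open>dist y z < R\<close> dist_xy by (auto simp: dist_commute)

    \<comment> \<open>\<open>\<phi> = v + b + w z\<close> touches \<open>u\<close> from below at \<open>z\<close>, by minimality of \<open>w z\<close>.\<close>
    define k where "k = (\<lambda>x. (w z - \<epsilon> * E) + \<epsilon> * gaussian \<alpha> y x)"
    define \<phi> where "\<phi> = (\<lambda>x. v x + k x)"
    have k: "C2_on \<Omega> k" unfolding k_def by (rule C2_on_gaussian)
    have \<phi>z: "\<phi> z = u z" by (simp add: \<phi>_def k_def w_def b_def)
    have "\<forall>\<^sub>F x in nhds z. x \<in> ball y R \<inter> ball xhat (R / 2)"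
      using z_int by (intro eventually_nhds_in_open) auto
    then have "\<forall>\<^sub>F x in nhds z. \<phi> x \<le> u x"
    proof eventually_elim
      case (elim x)
      then have "x \<in> K" by (auto simp: K_def)
      from z_min[OF this] have "w z \<le> u x - v x - b x" by (simp add: w_def)
      then show ?case by (simp add: \<phi>_def k_def b_def)
    qed
    from viscosity_leD[OF assms(8,1) z\<Omega> _ this \<phi>z]
    have "F z (\<phi> z) (gradient \<phi> z) (hessian \<phi> z) \<le> F z (v z) (gradient v z) (hessian v z)"
      unfolding \<phi>_def by (simp add: C2_on_add[OF assms(1) v(1) k])
    moreover have "F z (v z) (gradient v z) (hessian v z) < F z (\<phi> z) (gradient \<phi> z) (hessian \<phi> z)"
    proof -
      \<comment> \<open>Negativity of the minimum bounds the increment of the zeroth order argument by \<open>b z\<close>.\<close>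
      have "u z - v z \<le> \<epsilon> * gaussian \<alpha> y z"
        using wz mult_pos_pos[OF \<epsilon>(1) E] unfolding w_def b_def by linarith
      then have "F z (v z) (gradient v z) (hessian v z)
          < F z (v z + (u z - v z)) (gradient v z + gradient k z) (hessian v z + hessian k z)"
        unfolding k_def
        using uv by (intro increase z B z\<Omega> hessian_symmetric[OF assms(1) v(1)] \<epsilon>) auto
      moreover have "gradient \<phi> z = gradient v z + gradient k z" "hessian \<phi> z = hessian v z + hessian k z"
        unfolding \<phi>_def
        using gradient_add[OF assms(1) v(1) k z\<Omega>] hessian_add[OF assms(1) v(1) k z\<Omega>] by simp_all
      ultimately show ?thesis by (simp add: \<phi>z)
    qed
    ultimately show False by simp
  qed

  \<comment> \<open>The slope of \<open>b\<close> at \<open>xhat\<close> in direction \<open>\<nu>\<close> is \<open>2 \<epsilon> E \<alpha> R\<close>; half of it is a lower bound for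
    \<open>b / s\<close> up to \<open>s = R\<close>.\<close>
  define c where "c = \<epsilon> * E * (\<alpha> * R)"
  have c: "c > 0" using \<epsilon> E \<alpha> R by (simp add: c_def)
  have "c \<le> (u (xhat + s *\<^sub>R \<nu>) - v (xhat + s *\<^sub>R \<nu>)) / s" if s: "0 < s" "s < R / 2" for s
  proof -
    let ?x = "xhat + s *\<^sub>R \<nu>"
    have xy: "?x - y = - ((R - s) *\<^sub>R \<nu>)" by (simp add: y_def algebra_simps)
    have nxy: "norm (?x - y) = R - s" using \<nu> s by (simp add: xy)
    have "?x \<in> K" using nxy s \<nu> R by (simp add: K_def dist_norm norm_minus_commute)
    from w_nonneg[OF this] have "b ?x \<le> u ?x - v ?x" by (simp add: w_def)
    moreover have "c * s \<le> b ?x"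
    proof -
      have "- \<alpha> * (R - s)\<^sup>2 = - \<alpha> * R\<^sup>2 + \<alpha> * (2 * R - s) * s"
        by (simp add: power2_eq_square algebra_simps)
      then have gx: "gaussian \<alpha> y ?x = E * exp (\<alpha> * (2 * R - s) * s)"
        by (simp add: gaussian_def nxy E_def exp_add[symmetric])
      have "\<alpha> * R * s \<le> \<alpha> * (2 * R - s) * s"
        using \<alpha> s R by (intro mult_right_mono mult_left_mono) auto
      also have "\<dots> \<le> exp (\<alpha> * (2 * R - s) * s) - 1"
        using exp_ge_add_one_self[of "\<alpha> * (2 * R - s) * s"] by linarith
      finally have "(\<epsilon> * E) * (\<alpha> * R * s) \<le> (\<epsilon> * E) * (exp (\<alpha> * (2 * R - s) * s) - 1)"
        using \<epsilon> E by (intro mult_left_mono) auto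
      then show ?thesis by (simp add: c_def b_def gx algebra_simps)
    qed
    ultimately show ?thesis using s by (simp add: pos_le_divide_eq)
  qed
  then have "\<forall>\<^sub>F s in at_right 0. ereal c \<le> ereal ((u (xhat + s *\<^sub>R \<nu>) - v (xhat + s *\<^sub>R \<nu>)) / s)"
    using R by (intro eventually_at_rightI[of 0 "R / 2"]) (simp_all only: greaterThanLessThan_iff ereal_less_eq half_gt_zero)
  then have "ereal c \<le> Liminf (at_right 0) (\<lambda>s. ereal ((u (xhat + s *\<^sub>R \<nu>) - v (xhat + s *\<^sub>R \<nu>)) / s))"
    by (rule Liminf_bounded)
  then show ?thesis
    using c by (simp add: order.strict_trans2[of 0 "ereal c"])
qed

end
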